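(* The associate space of $L^\varphi(\Omega;\mathbb R^N)$ is $L^{\varphi^*}(\Omega;\mathbb R^N)$, with duality pairing $\langle p,v\rangle:=\int_\Omega p\cdot v\,dx$. Moreover, $L^\varphi(\Omega;\mathbb R^N)$ has order-continuous norm, and the norm dual can be identified with the associate space, i.e. $$\bigl(L^\varphi(\Omega;\mathbb R^N)\bigr)^*\simeq L^{\varphi^*}(\Omega;\mathbb R^N)$$ through the pairing $\langle p,v\rangle=\int_\Omega p\cdot v\,dx$ (the map sending $p$ to the functional $v\mapsto\int_\Omega p\cdot v\,dx$ is a linear bijection onto the dual, with equivalent norms). In particular, $$\int_\Omega|p\cdot v|\,dx\le 2\,\|p\|_{\varphi^*}\,\|v\|_\varphi$$ for all $v\in L^\varphi(\Omega;\mathbb R^N)$ and $p\in L^{\varphi^*}(\Omega;\mathbb R^N)$.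
   Context: $\Omega\subset\mathbb R^N$ is a bounded Lipschitz domain with Lebesgue measure. Measurable functions agreeing a.e. are identified; $L^0(\Omega;\mathbb R^N)$ is the space of measurable vector fields. Standing assumptions on $\varphi:\Omega\times[0,\infty)\to[0,\infty)$: $x\mapsto\varphi(x,t)$ is measurable for every $t\ge0$; for a.e. $x\in\Omega$ the map $t\mapsto\varphi(x,t)$ is convex, increasing (in the non-strict sense), continuous, and $\varphi(x,0)=0$; $\varphi(\cdot,t)\in L^1(\Omega)$ for every $t\ge0$; there is a constant $C_\Delta$ with $\varphi(x,2t)\le C_\Delta\varphi(x,t)$ for a.e. $x\in\Omega$ and all $t\ge0$; and $\lim_{t\to\infty}\operatorname{ess\,inf}_{x\in\Omega}\varphi(x,t)/t=\infty$. The pointwise conjugate is $\varphi^*(x,s):=\sup_{t\ge0}\{st-\varphi(x,t)\}$, $s\ge0$. For $\psi\in\{\varphi,\varphi^*\}$ and $v\in L^0(\Omega;\mathbb R^N)$ set $\rho_\psi(v):=\int_\Omega\psi(x,|v(x)|)\,dx$, $L^\psi(\Omega;\mathbb R^N):=\{v\in L^0(\Omega;\mathbb R^N):\rho_\psi(\lambda v)<\infty\text{ for some }\lambda>0\}$, with Luxemburg norm $\|v\|_\psi:=\inf\{\lambda>0:\rho_\psi(v/\lambda)\le1\}$. The associate space of $L^\varphi(\Omega;\mathbb R^N)$ consists of all $p\in L^0(\Omega;\mathbb R^N)$ with $\sup\{\int_\Omega|p\cdot v|\,dx:\ v\in L^\varphi(\Omega;\mathbb R^N),\ \|v\|_\varphi\le1\}<\infty$,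 this supremum being its norm; equality of the associate space with $L^{\varphi^*}(\Omega;\mathbb R^N)$ is understood as equality of sets with equivalent norms. Order continuity of the norm means: if $v,v_k\in L^\varphi(\Omega;\mathbb R^N)$ with $0\le|v_k|\le|v|$ a.e. and $v_k\to0$ a.e., then $\|v_k\|_\varphi\to0$. *)

theory Defs
  imports "HOL-Analysis.Analysis"
begin

text \<open>
  Near each boundary point the domain is the strict epigraph, in some unit direction \<open>e\<close>,
  of a Lipschitz function \<open>g\<close> of the variables orthogonal to \<open>e\<close>.
\<close>

definition lipschitz_domain :: "(real ^ 'n) set \<Rightarrow> bool" where
  "lipschitz_domain \<Omega> \<longleftrightarrow>
     open \<Omega> \<and> connected \<Omega> \<and> \<Omega> \<noteq> {} \<and>
     (\<forall>z\<in>frontier \<Omega>. \<exists>U e g L.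
        open U \<and> z \<in> U \<and> norm e = 1 \<and> L-lipschitz_on {y. y \<bullet> e = 0} g \<and>
        \<Omega> \<inter> U = {x \<in> U. g (x - (x \<bullet> e) *\<^sub>R e) < x \<bullet> e})"

definition ess_inf :: "'a measure \<Rightarrow> ('a \<Rightarrow> ereal) \<Rightarrow> ereal" where
  "ess_inf M f = Sup {c. AE x in M. c \<le> f x}"

text \<open>
  Integrands take values in \<open>[0,\<infty>]\<close>, so that the real-valued \<open>\<phi>\<close> (through \<open>integrand\<close>) and its
  conjugate are treated uniformly. The supremum defining the conjugate is nonnegative whenever
  \<open>\<phi> x 0 = 0\<close> (take \<open>t = 0\<close>), so \<^const>\<open>e2ennreal\<close> then loses nothing.
\<close>

abbreviation (input) integrand :: "('a \<Rightarrow> real \<Rightarrow> real) \<Rightarrow> 'a \<Rightarrow> real \<Rightarrow> ennreal" where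
  "integrand \<phi> \<equiv> (\<lambda>x t. ennreal (\<phi> x t))"

definition conjugate :: "('a \<Rightarrow> real \<Rightarrow> real) \<Rightarrow> 'a \<Rightarrow> real \<Rightarrow> ennreal" where
  "conjugate \<phi> x s = e2ennreal (SUP t\<in>{0..}. ereal (s * t - \<phi> x t))"

text \<open>
  Elements of \<open>L\<^sup>0\<close> and of the spaces below are represented by functions; identification of
  functions that agree almost everywhere is made explicit where it matters.
\<close>

definition L0 :: "(real ^ 'n) set \<Rightarrow> (real ^ 'n \<Rightarrow> real ^ 'n) set" where
  "L0 \<Omega> = borel_measurable (lebesgue_on \<Omega>)"

definition modular ::
  "(real ^ 'n) set \<Rightarrow> (real ^ 'n \<Rightarrow> real \<Rightarrow> ennreal) \<Rightarrow> (real ^ 'n \<Rightarrow> real ^ 'n) \<Rightarrow> ennreal" where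
  "modular \<Omega> \<psi> v = (\<integral>\<^sup>+ x. \<psi> x (norm (v x)) \<partial>lebesgue_on \<Omega>)"

definition orlicz_space ::
  "(real ^ 'n) set \<Rightarrow> (real ^ 'n \<Rightarrow> real \<Rightarrow> ennreal) \<Rightarrow> (real ^ 'n \<Rightarrow> real ^ 'n) set" where
  "orlicz_space \<Omega> \<psi> = {v \<in> L0 \<Omega>. \<exists>c>0. modular \<Omega> \<psi> (\<lambda>x. c *\<^sub>R v x) < \<infinity>}"

text \<open>Meaningful only on \<^const>\<open>orlicz_space\<close>, where the set below is nonempty.\<close>

definition lux_norm ::
  "(real ^ 'n) set \<Rightarrow> (real ^ 'n \<Rightarrow> real \<Rightarrow> ennreal) \<Rightarrow> (real ^ 'n \<Rightarrow> real ^ 'n) \<Rightarrow> real" where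
  "lux_norm \<Omega> \<psi> v = Inf {c. c > 0 \<and> modular \<Omega> \<psi> (\<lambda>x. v x /\<^sub>R c) \<le> 1}"

definition orlicz_ball ::
  "(real ^ 'n) set \<Rightarrow> (real ^ 'n \<Rightarrow> real \<Rightarrow> ennreal) \<Rightarrow> (real ^ 'n \<Rightarrow> real ^ 'n) set" where
  "orlicz_ball \<Omega> \<psi> = {v \<in> orlicz_space \<Omega> \<psi>. lux_norm \<Omega> \<psi> v \<le> 1}"

definition associate_sup ::
  "(real ^ 'n) set \<Rightarrow> (real ^ 'n \<Rightarrow> real \<Rightarrow> ennreal) \<Rightarrow> (real ^ 'n \<Rightarrow> real ^ 'n) \<Rightarrow> ennreal" where
  "associate_sup \<Omega> \<psi> p =
     (SUP v\<in>orlicz_ball \<Omega> \<psi>. \<integral>\<^sup>+ x. ennreal \<bar>p x \<bullet> v x\<bar> \<partial>lebesgue_on \<Omega>)"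

definition associate_space ::
  "(real ^ 'n) set \<Rightarrow> (real ^ 'n \<Rightarrow> real \<Rightarrow> ennreal) \<Rightarrow> (real ^ 'n \<Rightarrow> real ^ 'n) set" where
  "associate_space \<Omega> \<psi> = {p \<in> L0 \<Omega>. associate_sup \<Omega> \<psi> p < \<infinity>}"

definition associate_norm ::
  "(real ^ 'n) set \<Rightarrow> (real ^ 'n \<Rightarrow> real \<Rightarrow> ennreal) \<Rightarrow> (real ^ 'n \<Rightarrow> real ^ 'n) \<Rightarrow> real" where
  "associate_norm \<Omega> \<psi> p = enn2real (associate_sup \<Omega> \<psi> p)"

definition equivalent_norms_on :: "'a set \<Rightarrow> ('a \<Rightarrow> real) \<Rightarrow> ('a \<Rightarrow> real) \<Rightarrow> bool" where
  "equivalent_norms_on S m n \<longleftrightarrow>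
     (\<exists>c>0. \<exists>C>0. \<forall>p\<in>S. c * m p \<le> n p \<and> n p \<le> C * m p)"

definition order_continuous_norm ::
  "(real ^ 'n) set \<Rightarrow> (real ^ 'n \<Rightarrow> real \<Rightarrow> ennreal) \<Rightarrow> bool" where
  "order_continuous_norm \<Omega> \<psi> \<longleftrightarrow>
     (\<forall>v w. v \<in> orlicz_space \<Omega> \<psi> \<longrightarrow> (\<forall>k::nat. w k \<in> orlicz_space \<Omega> \<psi>) \<longrightarrow>
        (\<forall>k. AE x in lebesgue_on \<Omega>. norm (w k x) \<le> norm (v x)) \<longrightarrow>
        (AE x in lebesgue_on \<Omega>. (\<lambda>k. w k x) \<longlonglongrightarrow> 0) \<longrightarrow>
        (\<lambda>k. lux_norm \<Omega> \<psi> (w k)) \<longlonglongrightarrow> 0)"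

text \<open>
  Bounded linear functionals on the Orlicz space. Boundedness makes a functional agree on
  functions that are equal almost everywhere, since their difference has norm \<open>0\<close>; hence these are
  exactly the functionals on the space of equivalence classes. Extensionality (a fixed value
  off the space) makes equality of functionals mean equality on the space.
\<close>

definition norm_dual ::
  "(real ^ 'n) set \<Rightarrow> (real ^ 'n \<Rightarrow> real \<Rightarrow> ennreal) \<Rightarrow> ((real ^ 'n \<Rightarrow> real ^ 'n) \<Rightarrow> real) set" where
  "norm_dual \<Omega> \<psi> =
     {F \<in> extensional (orlicz_space \<Omega> \<psi>).
        (\<forall>u\<in>orlicz_space \<Omega> \<psi>. \<forall>v\<in>orlicz_space \<Omega> \<psi>. \<forall>a b.
           F (\<lambda>x. a *\<^sub>R u x + b *\<^sub>R v x) = a * F u + b * F v) \<and>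
        (\<exists>C. \<forall>v\<in>orlicz_space \<Omega> \<psi>. \<bar>F v\<bar> \<le> C * lux_norm \<Omega> \<psi> v)}"

definition dual_norm ::
  "(real ^ 'n) set \<Rightarrow> (real ^ 'n \<Rightarrow> real \<Rightarrow> ennreal) \<Rightarrow> ((real ^ 'n \<Rightarrow> real ^ 'n) \<Rightarrow> real) \<Rightarrow> real" where
  "dual_norm \<Omega> \<psi> F = (SUP v\<in>orlicz_ball \<Omega> \<psi>. \<bar>F v\<bar>)"

definition pairing ::
  "(real ^ 'n) set \<Rightarrow> (real ^ 'n \<Rightarrow> real ^ 'n) \<Rightarrow> (real ^ 'n \<Rightarrow> real ^ 'n) \<Rightarrow> real" where
  "pairing \<Omega> p v = (\<integral>x. p x \<bullet> v x \<partial>lebesgue_on \<Omega>)"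

definition pairing_functional ::
  "(real ^ 'n) set \<Rightarrow> (real ^ 'n \<Rightarrow> real \<Rightarrow> ennreal) \<Rightarrow>
     (real ^ 'n \<Rightarrow> real ^ 'n) \<Rightarrow> (real ^ 'n \<Rightarrow> real ^ 'n) \<Rightarrow> real" where
  "pairing_functional \<Omega> \<psi> p = restrict (pairing \<Omega> p) (orlicz_space \<Omega> \<psi>)"

end

(*
  For the inclusion of the associate space in L^{phi*}: testing p against almost optimal bounded
  competitors t(x) p(x)/|p(x)| in the supremum that defines phi*(x, |p(x)|) shows that a bound K for
  the pairing of p with the unit ball forces the phi*-modular of p/K to be at most 1. The converse
  bound is Young's inequality. The doubling condition makes all modulars of multiples of an element
  of L^phi finite, so dominated convergence gives order continuity. Order continuity makes
  A |-> F(1_A e_i) a finite signed measure for every F in the dual; its Radon-Nikodym densities are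
  the components of an integrable p that represents F on bounded fields. The test argument puts p in
  L^{phi*}, and truncation extends the representation to all of L^phi.
*)

theory Submission
  imports Defs
begin

text \<open>The test argument has little to work with: p is merely integrable, and for a functional
  F the representation is at first known only on bounded fields. So every competitor must be
  measurable in x and bounded by one constant on all of \<Omega>, although
  \<open>\<phi>\<^sup>*\<close> may be infinite and a maximizing t need not exist. Comparing
  finitely many nonnegative rationals at a time provides this: the n-th choice takes values in a
  fixed finite set, and its gains increase to \<open>\<phi>\<^sup>*(x, |p(x)|)\<close>, so that
  monotone convergence finishes the argument. One test lemma then serves three times: for the
  associate space, for the Radon-Nikodym density of F, and for the lower bound of the dual norm. It
  yields the constant 1; the constant 2 on the other side comes from adding two modulars that are at
  most 1 in Young's inequality. Since the set functions of F have no sign, a signed Radon-Nikodym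
  theorem is derived first, from positive variations. Throughout, the conditions on \<phi> are taken
  to hold at every point; exceptional null sets are removed only at the end.\<close>

section \<open>Signed measures\<close>

text \<open>Real values make the measure finite. The value at the empty set is not prescribed; it
  follows from convergence of a constant series.\<close>

definition signed_measure :: "'a measure \<Rightarrow> ('a set \<Rightarrow> real) \<Rightarrow> bool" where
  "signed_measure M \<nu> \<longleftrightarrow>
     (\<forall>A. range A \<subseteq> sets M \<longrightarrow> disjoint_family A \<longrightarrow> (\<lambda>n. \<nu> (A n)) sums \<nu> (\<Union>n. A n))"

lemma signed_measureD:
  "signed_measure M \<nu> \<Longrightarrow> range A \<subseteq> sets M \<Longrightarrow> disjoint_family A
    \<Longrightarrow> (\<lambda>n. \<nu> (A n)) sums \<nu> (\<Union>n. A n)"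
  by (simp add: signed_measure_def)

text \<open>The positive part of the Jordan decomposition, written as a supremum so that no Hahn set
  has to be constructed. \<open>ennreal\<close> clips negative values to 0, a value that the subset
  \<open>{}\<close> attains anyway.\<close>

definition positive_variation :: "'a measure \<Rightarrow> ('a set \<Rightarrow> real) \<Rightarrow> 'a set \<Rightarrow> ennreal" where
  "positive_variation M \<nu> A = (SUP B\<in>{B \<in> sets M. B \<subseteq> A}. ennreal (\<nu> B))"

lemma signed_measure_additive:
  fixes \<nu> :: "'a set \<Rightarrow> real"
  assumes sgn: "signed_measure M \<nu>"
    and "A \<in> sets M" "B \<in> sets M" "A \<inter> B = {}"
  shows "\<nu> {} = 0" and "\<nu> (A \<union> B) = \<nu> A + \<nu> B"
proof -
  \<comment> \<open>The constant sequence of empty sets is a disjoint family, and a constant series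
    converges only if its term is 0.\<close>
  show 0: "\<nu> {} = 0"
    using signed_measureD[OF sgn, of "\<lambda>_. {}"] by (auto simp: disjoint_family_on_def sums_iff summable_const_iff)
  have "(\<lambda>n. \<nu> (binaryset A B n)) sums \<nu> (\<Union>n. binaryset A B n)"
    using assms(2-4) by (intro signed_measureD[OF sgn]) (auto simp: binaryset_def disjoint_family_on_def)
  moreover have "(\<lambda>n. \<nu> (binaryset A B n)) sums (\<nu> A + \<nu> B)"
    by (intro binaryset_sums 0)
  ultimately show "\<nu> (A \<union> B) = \<nu> A + \<nu> B"
    by (simp add: UN_binaryset_eq sums_iff)
qed

lemma positive_variation_upper:
  "B \<in> sets M \<Longrightarrow> B \<subseteq> A \<Longrightarrow> ennreal (\<nu> B) \<le> positive_variation M \<nu> A"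
  unfolding positive_variation_def by (rule SUP_upper) auto

lemma positive_variation_superadditive:
  assumes sgn: "signed_measure M \<nu>"
    and disj: "A \<inter> B = {}"
  shows "positive_variation M \<nu> A + positive_variation M \<nu> B \<le> positive_variation M \<nu> (A \<union> B)"
proof -
  have *: "ennreal (\<nu> X) + ennreal (\<nu> Y) \<le> positive_variation M \<nu> (A \<union> B)"
    if "X \<in> sets M" "X \<subseteq> A" "Y \<in> sets M" "Y \<subseteq> B" for X Y
  proof -
    have "\<nu> (X \<union> Y) = \<nu> X + \<nu> Y"
      using that disj by (intro signed_measure_additive(2)[OF sgn]) auto
    \<comment> \<open>If one of the two values is negative, \<open>ennreal\<close> clips it and the
      sum collapses to the other one; hence the bounds for X and Y alone.\<close>
    moreover have "ennreal (\<nu> X) \<le> positive_variation M \<nu> (A \<union> B)"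
      "ennreal (\<nu> Y) \<le> positive_variation M \<nu> (A \<union> B)"
      "ennreal (\<nu> (X \<union> Y)) \<le> positive_variation M \<nu> (A \<union> B)"
      by (rule positive_variation_upper; use that in blast)+
    ultimately show ?thesis
      unfolding ennreal_plus_if by presburger
  qed
  have "{} \<in> {B \<in> sets M. B \<subseteq> X}" for X by simp
  then have ne: "{B \<in> sets M. B \<subseteq> X} \<noteq> {}" for X by blast
  show ?thesis
    unfolding positive_variation_def[of _ _ A] positive_variation_def[of _ _ B]
      ennreal_SUP_add_left[OF ne, symmetric] ennreal_SUP_add_right[OF ne]
    by (auto intro!: SUP_least *)
qed

text \<open>Superadditivity on finite unions gives one inequality. For the other, a subset B of the
  union is cut into the pieces \<open>B \<inter> A n\<close>, to which countable additivity of \<nu>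
  applies.\<close>

lemma positive_variation_countably_additive:
  assumes sgn: "signed_measure M \<nu>"
  shows "countably_additive (sets M) (positive_variation M \<nu>)"
  unfolding countably_additive_def
proof safe
  fix A :: "nat \<Rightarrow> 'a set"
  assume A: "range A \<subseteq> sets M" and disj: "disjoint_family A"
  let ?\<mu> = "positive_variation M \<nu>"
  have "(\<Sum>n<N. ?\<mu> (A n)) \<le> ?\<mu> (\<Union>n<N. A n)" for N
  proof (induction N)
    case (Suc N)
    have "(\<Sum>n<Suc N. ?\<mu> (A n)) \<le> ?\<mu> (\<Union>n<N. A n) + ?\<mu> (A N)"
      using Suc by (simp add: add_mono)
    also have "\<dots> \<le> ?\<mu> ((\<Union>n<N. A n) \<union> A N)"
      using disj by (intro positive_variation_superadditive[OF sgn])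
        (auto simp: disjoint_family_on_def dest!: less_imp_neq)
    also have "(\<Union>n<N. A n) \<union> A N = (\<Union>n<Suc N. A n)"
      by (auto simp: lessThan_Suc)
    finally show ?case .
  qed simp
  moreover have "?\<mu> (\<Union>n<N. A n) \<le> ?\<mu> (\<Union>n. A n)" for N
    unfolding positive_variation_def by (rule SUP_subset_mono) auto
  ultimately have "(\<Sum>n<N. ?\<mu> (A n)) \<le> ?\<mu> (\<Union>n. A n)" for N
    using order_trans by blast
  then have "(\<Sum>n. ?\<mu> (A n)) \<le> ?\<mu> (\<Union>n. A n)"
    by (intro suminf_le_const) auto
  moreover have "?\<mu> (\<Union>n. A n) \<le> (\<Sum>n. ?\<mu> (A n))"
    unfolding positive_variation_def[of _ _ "\<Union>n. A n"]
  proof (safe intro!: SUP_least)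
    fix B assume B: "B \<in> sets M" "B \<subseteq> (\<Union>n. A n)"
    have "(\<lambda>n. \<nu> (B \<inter> A n)) sums \<nu> (\<Union>n. B \<inter> A n)"
      using A B disj by (intro signed_measureD[OF sgn]) (fastforce simp: disjoint_family_on_def)+
    moreover have "(\<Union>n. B \<inter> A n) = B" using B by auto
    ultimately have lim: "(\<lambda>N. ennreal (\<Sum>n<N. \<nu> (B \<inter> A n))) \<longlonglongrightarrow> ennreal (\<nu> B)"
      by (auto simp: sums_def intro: tendsto_ennrealI)
    \<comment> \<open>Splitting off a term under \<open>ennreal\<close> gives only an inequality,
      because the pieces may have negative value.\<close>
    have "ennreal (\<Sum>n<N. \<nu> (B \<inter> A n)) \<le> (\<Sum>n<N. ?\<mu> (A n))" for N
    proof (induction N)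
      case (Suc N)
      have "ennreal (\<Sum>n<Suc N. \<nu> (B \<inter> A n)) \<le> ennreal (\<Sum>n<N. \<nu> (B \<inter> A n)) + ennreal (\<nu> (B \<inter> A N))"
        by (auto simp: ennreal_plus_if simp del: ennreal_plus intro: ennreal_leI)
      also have "\<dots> \<le> (\<Sum>n<N. ?\<mu> (A n)) + ?\<mu> (A N)"
        using A B by (intro add_mono Suc positive_variation_upper) auto
      finally show ?case by simp
    qed simp
    moreover have "(\<Sum>n<N. ?\<mu> (A n)) \<le> (\<Sum>n. ?\<mu> (A n))" for N
      by (intro sum_le_suminf) auto
    ultimately show "ennreal (\<nu> B) \<le> (\<Sum>n. ?\<mu> (A n))"
      by (intro LIMSEQ_le_const2[OF lim]) (blast intro: order_trans)
  qed
  ultimately show "(\<Sum>n. ?\<mu> (A n)) = ?\<mu> (\<Union>n. A n)"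
    by (rule antisym)
qed

text \<open>The positive variation is a measure of total mass at most K that vanishes on null sets,
  so Radon-Nikodym applies. Finite mass makes the density finite almost everywhere, and
  \<open>enn2real\<close> then gives a real version.\<close>

lemma (in finite_measure) positive_variation_density:
  fixes \<nu> :: "'a set \<Rightarrow> real"
  assumes sgn: "signed_measure M \<nu>"
    and bdd: "\<And>A. A \<in> sets M \<Longrightarrow> \<nu> A \<le> K"
    and null: "\<And>A. A \<in> null_sets M \<Longrightarrow> \<nu> A = 0"
  obtains f :: "'a \<Rightarrow> real" where "integrable M f" "\<And>x. 0 \<le> f x"
    "\<And>A. A \<in> sets M \<Longrightarrow> positive_variation M \<nu> A = ennreal (\<integral>x. indicator A x * f x \<partial>M)"
proof -
  let ?\<mu> = "positive_variation M \<nu>"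
  define N where "N = measure_of (space M) (sets M) ?\<mu>"
  have sets_N[simp]: "sets N = sets M"
    by (auto simp: N_def)
  have fin: "?\<mu> A \<le> ennreal K" for A
    unfolding positive_variation_def using bdd by (auto intro!: SUP_least ennreal_leI)
  have \<mu>0: "?\<mu> A = 0" if "A \<in> null_sets M" for A
    unfolding positive_variation_def using null_sets_subset[OF that] null
    by (intro antisym SUP_least) auto
  have N: "emeasure N A = ?\<mu> A" if "A \<in> sets M" for A
  proof -
    have "positive (sets M) ?\<mu>"
      by (simp add: positive_def \<mu>0)
    then show ?thesis
      unfolding N_def using that positive_variation_countably_additive[OF sgn]
      by (intro emeasure_measure_of_sigma sets.sigma_algebra_axioms) auto
  qed
  have "absolutely_continuous M N"
    unfolding absolutely_continuous_def by (auto simp: null_sets_def N \<mu>0)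
  from Radon_Nikodym[OF this sets_N] obtain h
    where h[measurable]: "h \<in> borel_measurable M" and dN: "density M h = N" by auto
  have \<mu>h: "?\<mu> A = (\<integral>\<^sup>+x. h x * indicator A x \<partial>M)" if "A \<in> sets M" for A
    using that by (subst N[symmetric]) (auto simp flip: dN simp: emeasure_density)
  have "(\<integral>\<^sup>+x. h x \<partial>M) = ?\<mu> (space M)"
    by (subst \<mu>h) (auto intro!: nn_integral_cong)
  then have fin_h: "(\<integral>\<^sup>+x. h x \<partial>M) < \<infinity>"
    using fin[of "space M"] by (simp add: ennreal_less_top le_less_trans)
  then have ae: "AE x in M. ennreal (enn2real (h x)) = h x"
    using nn_integral_PInf_AE[OF h] by (auto simp: less_top)
  have int: "integrable M (\<lambda>x. enn2real (h x))"
  proof (rule integrableI_bounded)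
    have "(\<integral>\<^sup>+x. ennreal (norm (enn2real (h x))) \<partial>M) = (\<integral>\<^sup>+x. h x \<partial>M)"
      using ae by (intro nn_integral_cong_AE) auto
    then show "(\<integral>\<^sup>+x. ennreal (norm (enn2real (h x))) \<partial>M) < \<infinity>" using fin_h by simp
  qed simp
  show ?thesis
  proof (rule that[of "\<lambda>x. enn2real (h x)"])
    fix A assume A: "A \<in> sets M"
    have "ennreal (\<integral>x. indicator A x * enn2real (h x) \<partial>M)
        = (\<integral>\<^sup>+x. ennreal (indicator A x * enn2real (h x)) \<partial>M)"
      using integrable_mult_indicator[OF A int] by (intro nn_integral_eq_integral[symmetric]) auto
    also have "\<dots> = (\<integral>\<^sup>+x. h x * indicator A x \<partial>M)"
      using ae by (intro nn_integral_cong_AE) (auto simp: indicator_def)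
    finally show "?\<mu> A = ennreal (\<integral>x. indicator A x * enn2real (h x) \<partial>M)"
      using \<mu>h[OF A] by simp
  qed (use int in auto)
qed

text \<open>Jordan decomposition by complements: for \<open>B \<subseteq> A\<close>,
  \<open>\<nu> B = \<nu> A - \<nu> (A - B)\<close> is at most \<nu> A plus the negative variation of
  A. The supremum over B, together with the same bound for -\<nu>, gives \<nu> as the difference of
  the two variations.\<close>

lemma (in finite_measure) signed_Radon_Nikodym:
  fixes \<nu> :: "'a set \<Rightarrow> real"
  assumes sgn: "signed_measure M \<nu>"
    and bdd: "\<And>A. A \<in> sets M \<Longrightarrow> \<bar>\<nu> A\<bar> \<le> K"
    and null: "\<And>A. A \<in> null_sets M \<Longrightarrow> \<nu> A = 0"
  obtains f :: "'a \<Rightarrow> real" where "integrable M f"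
    "\<And>A. A \<in> sets M \<Longrightarrow> \<nu> A = (\<integral>x. indicator A x * f x \<partial>M)"
proof -
  have sgn': "signed_measure M (\<lambda>A. - \<nu> A)"
    using sgn by (auto simp: signed_measure_def intro: sums_minus)
  have bdd': "\<nu> A \<le> K" "- \<nu> A \<le> K" if "A \<in> sets M" for A
    using bdd[OF that] by auto
  have null': "- \<nu> A = 0" if "A \<in> null_sets M" for A
    using null[OF that] by simp
  obtain f where f: "integrable M f" "\<And>x. 0 \<le> f x"
    "\<And>A. A \<in> sets M \<Longrightarrow> positive_variation M \<nu> A = ennreal (\<integral>x. indicator A x * f x \<partial>M)"
    using positive_variation_density[OF sgn bdd'(1) null] by blast
  obtain g where g: "integrable M g" "\<And>x. 0 \<le> g x"
    "\<And>A. A \<in> sets M \<Longrightarrow> positive_variation M (\<lambda>A. - \<nu> A) A = ennreal (\<integral>x. indicator A x * g x \<partial>M)"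
    using positive_variation_density[OF sgn' bdd'(2) null'] by blast
  have "\<nu> A = (\<integral>x. indicator A x * (f x - g x) \<partial>M)" if A: "A \<in> sets M" for A
  proof -
    let ?f = "\<integral>x. indicator A x * f x \<partial>M" and ?g = "\<integral>x. indicator A x * g x \<partial>M"
    have nn: "0 \<le> ?f" "0 \<le> ?g"
      using f g by auto
    have compl: "\<nu> B + \<nu> (A - B) = \<nu> A" if "B \<in> sets M" "B \<subseteq> A" for B
    proof -
      have "\<nu> (B \<union> (A - B)) = \<nu> B + \<nu> (A - B)"
        using that A by (intro signed_measure_additive(2)[OF sgn]) auto
      moreover have "B \<union> (A - B) = A" using that by auto
      ultimately show ?thesis by simp
    qed
    have "\<nu> B \<le> ?g + \<nu> A" if "B \<in> sets M" "B \<subseteq> A" for B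
    proof -
      have "ennreal (- \<nu> (A - B)) \<le> ennreal ?g"
        using that A g(3)[OF A] positive_variation_upper[of "A - B" M A "\<lambda>A. - \<nu> A"] by auto
      then show ?thesis using compl[OF that] nn by simp
    qed
    moreover have "- \<nu> B \<le> ?f - \<nu> A" if "B \<in> sets M" "B \<subseteq> A" for B
    proof -
      have "ennreal (\<nu> (A - B)) \<le> ennreal ?f"
        using that A f(3)[OF A] positive_variation_upper[of "A - B" M A \<nu>] by auto
      then show ?thesis using compl[OF that] nn by simp
    qed
    ultimately have "positive_variation M \<nu> A \<le> ennreal (?g + \<nu> A)"
      and "positive_variation M (\<lambda>A. - \<nu> A) A \<le> ennreal (?f - \<nu> A)"
      by (auto simp: positive_variation_def intro!: SUP_least ennreal_leI)
    then have "ennreal ?f \<le> ennreal (?g + \<nu> A)" "ennreal ?g \<le> ennreal (?f - \<nu> A)"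
      using f(3) g(3) A by auto
    moreover have "\<nu> {} = 0"
      using null by auto
    \<comment> \<open>The choice \<open>B = {}\<close> shows that the right-hand sides are
      nonnegative, so \<open>ennreal\<close> can be removed from both inequalities.\<close>
    then have "0 \<le> ?g + \<nu> A" "0 \<le> ?f - \<nu> A"
      using \<open>\<And>B. B \<in> sets M \<Longrightarrow> B \<subseteq> A \<Longrightarrow> \<nu> B \<le> _\<close>[of "{}"]
        \<open>\<And>B. B \<in> sets M \<Longrightarrow> B \<subseteq> A \<Longrightarrow> - \<nu> B \<le> _\<close>[of "{}"] by auto
    ultimately have "\<nu> A = ?f - ?g"
      by simp
    also have "\<dots> = (\<integral>x. indicator A x * f x - indicator A x * g x \<partial>M)"
      using integrable_mult_indicator[OF A f(1)] integrable_mult_indicator[OF A g(1)]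
      by (intro Bochner_Integration.integral_diff[symmetric]) auto
    finally show ?thesis by (simp add: right_diff_distrib)
  qed
  then show ?thesis
    using f g by (intro that[of "\<lambda>x. f x - g x"]) auto
qed

section \<open>Luxemburg norms of convex integrands\<close>

text \<open>The common ground of \<phi> and its conjugate: infinite values are allowed and no
  doubling is imposed, since the conjugate may be infinite and need not be doubling.\<close>

locale convex_integrand =
  fixes \<Omega> :: "(real ^ 'n) set" and \<psi> :: "real ^ 'n \<Rightarrow> real \<Rightarrow> ennreal"
  assumes measurable_comp: "v \<in> L0 \<Omega> \<Longrightarrow> (\<lambda>x. \<psi> x (norm (v x))) \<in> borel_measurable (lebesgue_on \<Omega>)"
    and zero: "\<psi> x 0 = 0"
    and mono: "0 \<le> s \<Longrightarrow> s \<le> t \<Longrightarrow> \<psi> x s \<le> \<psi> x t"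
    and convex: "0 \<le> s \<Longrightarrow> 0 \<le> t \<Longrightarrow> 0 \<le> a \<Longrightarrow> 0 \<le> b \<Longrightarrow> a + b = 1 \<Longrightarrow>
      \<psi> x (a * s + b * t) \<le> ennreal a * \<psi> x s + ennreal b * \<psi> x t"
begin

lemma scale_le: "0 \<le> a \<Longrightarrow> a \<le> 1 \<Longrightarrow> 0 \<le> t \<Longrightarrow> \<psi> x (a * t) \<le> ennreal a * \<psi> x t"
  using convex[of t 0 a "1 - a" x] by (simp add: zero)

lemma L0_scaleR: "v \<in> L0 \<Omega> \<Longrightarrow> (\<lambda>x. c *\<^sub>R v x) \<in> L0 \<Omega>"
  by (simp add: L0_def)

lemma L0_add: "u \<in> L0 \<Omega> \<Longrightarrow> v \<in> L0 \<Omega> \<Longrightarrow> (\<lambda>x. u x + v x) \<in> L0 \<Omega>"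
  by (simp add: L0_def)

lemma modular_mono:
  assumes "AE x in lebesgue_on \<Omega>. norm (u x) \<le> norm (v x)"
  shows "modular \<Omega> \<psi> u \<le> modular \<Omega> \<psi> v"
  unfolding modular_def using assms by (intro nn_integral_mono_AE) (auto elim!: eventually_mono intro: mono)

lemma modular_scale_le:
  assumes "v \<in> L0 \<Omega>" "0 \<le> a" "a \<le> 1"
  shows "modular \<Omega> \<psi> (\<lambda>x. a *\<^sub>R v x) \<le> ennreal a * modular \<Omega> \<psi> v"
proof -
  have "modular \<Omega> \<psi> (\<lambda>x. a *\<^sub>R v x) \<le> (\<integral>\<^sup>+x. ennreal a * \<psi> x (norm (v x)) \<partial>lebesgue_on \<Omega>)"
    unfolding modular_def using assms by (intro nn_integral_mono) (auto intro: scale_le)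
  also have "\<dots> = ennreal a * modular \<Omega> \<psi> v"
    unfolding modular_def using measurable_comp[OF assms(1)] by (rule nn_integral_cmult)
  finally show ?thesis .
qed

text \<open>Serves closure of the space under addition, where only finiteness matters; the factor
  1/2 that convexity gives is therefore given away.\<close>

lemma modular_midpoint_le:
  assumes "u \<in> L0 \<Omega>" "v \<in> L0 \<Omega>"
  shows "modular \<Omega> \<psi> (\<lambda>x. (1/2) *\<^sub>R (u x + v x)) \<le> modular \<Omega> \<psi> u + modular \<Omega> \<psi> v"
proof -
  have "\<psi> x (norm ((1/2) *\<^sub>R (u x + v x))) \<le> \<psi> x (norm (u x)) + \<psi> x (norm (v x))" for x
  proof -
    have "\<psi> x (norm ((1/2) *\<^sub>R (u x + v x))) \<le> \<psi> x (1/2 * norm (u x) + 1/2 * norm (v x))"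
      using norm_triangle_ineq[of "u x" "v x"] by (intro mono) auto
    also have "\<dots> \<le> ennreal (1/2) * \<psi> x (norm (u x)) + ennreal (1/2) * \<psi> x (norm (v x))"
      by (rule convex) auto
    also have "\<dots> \<le> 1 * \<psi> x (norm (u x)) + 1 * \<psi> x (norm (v x))"
      by (intro add_mono mult_right_mono) (auto simp: ennreal_le_1[of "1/2"] simp del: ennreal_half)
    finally show ?thesis by simp
  qed
  then have "modular \<Omega> \<psi> (\<lambda>x. (1/2) *\<^sub>R (u x + v x))
      \<le> (\<integral>\<^sup>+x. \<psi> x (norm (u x)) + \<psi> x (norm (v x)) \<partial>lebesgue_on \<Omega>)"
    unfolding modular_def by (intro nn_integral_mono)
  also have "\<dots> = modular \<Omega> \<psi> u + modular \<Omega> \<psi> v"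
    unfolding modular_def using measurable_comp assms by (intro nn_integral_add)
  finally show ?thesis .
qed

lemma orlicz_space_L0: "v \<in> orlicz_space \<Omega> \<psi> \<Longrightarrow> v \<in> L0 \<Omega>"
  by (simp add: orlicz_space_def)

lemma orlicz_spaceI: "v \<in> L0 \<Omega> \<Longrightarrow> 0 < c \<Longrightarrow> modular \<Omega> \<psi> (\<lambda>x. c *\<^sub>R v x) < \<infinity> \<Longrightarrow> v \<in> orlicz_space \<Omega> \<psi>"
  by (auto simp: orlicz_space_def)

lemma orlicz_space_scaleR:
  assumes "v \<in> orlicz_space \<Omega> \<psi>"
  shows "(\<lambda>x. a *\<^sub>R v x) \<in> orlicz_space \<Omega> \<psi>"
proof -
  obtain c where c: "c > 0" "modular \<Omega> \<psi> (\<lambda>x. c *\<^sub>R v x) < \<infinity>"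
    using assms by (auto simp: orlicz_space_def)
  \<comment> \<open>The denominator \<open>\<bar>a\<bar> + 1\<close> keeps the scale positive and
    covers \<open>a = 0\<close> as well.\<close>
  have le: "\<bar>a\<bar> * c / (\<bar>a\<bar> + 1) \<le> c"
    using c by (simp add: field_simps)
  have "modular \<Omega> \<psi> (\<lambda>x. (c / (\<bar>a\<bar> + 1)) *\<^sub>R (a *\<^sub>R v x)) \<le> modular \<Omega> \<psi> (\<lambda>x. c *\<^sub>R v x)"
    using c mult_right_mono[OF le norm_ge_zero] by (intro modular_mono) (auto simp: abs_mult mult.commute)
  with c show ?thesis
    by (intro orlicz_spaceI[of _ "c / (\<bar>a\<bar> + 1)"] L0_scaleR[OF orlicz_space_L0[OF assms]]) auto
qed

lemma orlicz_space_mono: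
  assumes "v \<in> orlicz_space \<Omega> \<psi>" "u \<in> L0 \<Omega>" "AE x in lebesgue_on \<Omega>. norm (u x) \<le> norm (v x)"
  shows "u \<in> orlicz_space \<Omega> \<psi>"
proof -
  obtain c where c: "c > 0" "modular \<Omega> \<psi> (\<lambda>x. c *\<^sub>R v x) < \<infinity>"
    using assms(1) by (auto simp: orlicz_space_def)
  have "modular \<Omega> \<psi> (\<lambda>x. c *\<^sub>R u x) \<le> modular \<Omega> \<psi> (\<lambda>x. c *\<^sub>R v x)"
    using c assms(3) by (intro modular_mono) auto
  with c assms(2) show ?thesis
    by (intro orlicz_spaceI[of u c]) auto
qed

lemma orlicz_space_add:
  assumes u: "u \<in> orlicz_space \<Omega> \<psi>" and v: "v \<in> orlicz_space \<Omega> \<psi>"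
  shows "(\<lambda>x. u x + v x) \<in> orlicz_space \<Omega> \<psi>"
proof -
  obtain c where c: "c > 0" "modular \<Omega> \<psi> (\<lambda>x. c *\<^sub>R u x) < \<infinity>"
    using u by (auto simp: orlicz_space_def)
  obtain d where d: "d > 0" "modular \<Omega> \<psi> (\<lambda>x. d *\<^sub>R v x) < \<infinity>"
    using v by (auto simp: orlicz_space_def)
  define e where "e = min c d"
  have "modular \<Omega> \<psi> (\<lambda>x. e *\<^sub>R u x) \<le> modular \<Omega> \<psi> (\<lambda>x. c *\<^sub>R u x)"
    "modular \<Omega> \<psi> (\<lambda>x. e *\<^sub>R v x) \<le> modular \<Omega> \<psi> (\<lambda>x. d *\<^sub>R v x)"
    using c d by (auto simp: e_def intro!: modular_mono AE_I2 mult_right_mono)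
  then have fin: "modular \<Omega> \<psi> (\<lambda>x. e *\<^sub>R u x) + modular \<Omega> \<psi> (\<lambda>x. e *\<^sub>R v x) < \<infinity>"
    using c d by (simp add: le_less_trans)
  have "modular \<Omega> \<psi> (\<lambda>x. (1/2) *\<^sub>R (e *\<^sub>R u x + e *\<^sub>R v x)) < \<infinity>"
    by (rule le_less_trans[OF modular_midpoint_le fin]) (intro L0_scaleR orlicz_space_L0 u v)+
  moreover have "(\<lambda>x. (1/2) *\<^sub>R (e *\<^sub>R u x + e *\<^sub>R v x)) = (\<lambda>x. (e/2) *\<^sub>R (u x + v x))"
    by (simp add: scaleR_add_right)
  ultimately have *: "modular \<Omega> \<psi> (\<lambda>x. (e/2) *\<^sub>R (u x + v x)) < \<infinity>"
    by (simp only:)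
  have "e / 2 > 0"
    using c d by (simp add: e_def)
  from orlicz_spaceI[OF L0_add[OF u[THEN orlicz_space_L0] v[THEN orlicz_space_L0]] this *]
  show ?thesis .
qed

text \<open>Convexity and the value 0 at 0: shrinking a field of finite modular m by the factor
  \<open>1 / (m + 1)\<close> brings its modular down to at most \<open>m / (m + 1)\<close>. Thus the
  infimum in \<open>lux_norm\<close> is over a nonempty set.\<close>

lemma
  assumes "v \<in> orlicz_space \<Omega> \<psi>"
  shows lux_set_nonempty: "\<exists>c>0. modular \<Omega> \<psi> (\<lambda>x. v x /\<^sub>R c) \<le> 1"
    and lux_norm_nonneg: "0 \<le> lux_norm \<Omega> \<psi> v"
proof -
  obtain c where c: "c > 0" "modular \<Omega> \<psi> (\<lambda>x. c *\<^sub>R v x) < \<infinity>"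
    using assms by (auto simp: orlicz_space_def)
  obtain m where m: "m \<ge> 0" "modular \<Omega> \<psi> (\<lambda>x. c *\<^sub>R v x) = ennreal m"
    using c by (cases "modular \<Omega> \<psi> (\<lambda>x. c *\<^sub>R v x)") auto
  have "modular \<Omega> \<psi> (\<lambda>x. (1 / (m + 1)) *\<^sub>R (c *\<^sub>R v x)) \<le> ennreal (1 / (m + 1)) * ennreal m"
    unfolding m(2)[symmetric] using m(1)
    by (intro modular_scale_le L0_scaleR[OF orlicz_space_L0[OF assms]]) auto
  also have "\<dots> = ennreal (1 / (m + 1) * m)"
    using m by (intro ennreal_mult[symmetric]) auto
  also have "\<dots> \<le> 1"
    using m by (simp add: field_simps)
  also have "(\<lambda>x. (1 / (m + 1)) *\<^sub>R (c *\<^sub>R v x)) = (\<lambda>x. v x /\<^sub>R ((m + 1) / c))"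
    by (simp add: fun_eq_iff)
  finally have "modular \<Omega> \<psi> (\<lambda>x. v x /\<^sub>R ((m + 1) / c)) \<le> 1" .
  then show "\<exists>c>0. modular \<Omega> \<psi> (\<lambda>x. v x /\<^sub>R c) \<le> 1"
    using c m by (intro exI[of _ "(m + 1) / c"]) auto
  then show "0 \<le> lux_norm \<Omega> \<psi> v"
    unfolding lux_norm_def by (intro cInf_greatest) auto
qed

lemma lux_norm_le:
  assumes "0 < c" "modular \<Omega> \<psi> (\<lambda>x. v x /\<^sub>R c) \<le> 1"
  shows "lux_norm \<Omega> \<psi> v \<le> c"
  unfolding lux_norm_def using assms by (intro cInf_lower bdd_belowI[of _ 0]) auto

text \<open>Strictness supplies an admissible \<open>d < c\<close>, from which monotonicity of the
  integrand reaches c. Sharp estimates follow by letting c decrease to the norm.\<close>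

lemma modular_le_1_if_lux_norm_less:
  assumes v: "v \<in> orlicz_space \<Omega> \<psi>" and c: "lux_norm \<Omega> \<psi> v < c"
  shows "modular \<Omega> \<psi> (\<lambda>x. v x /\<^sub>R c) \<le> 1"
proof -
  have "{c. c > 0 \<and> modular \<Omega> \<psi> (\<lambda>x. v x /\<^sub>R c) \<le> 1} \<noteq> {}"
    using lux_set_nonempty[OF v] by auto
  from cInf_lessD[OF this c[unfolded lux_norm_def]] obtain d
    where d: "d > 0" "modular \<Omega> \<psi> (\<lambda>x. v x /\<^sub>R d) \<le> 1" "d < c" by auto
  have "modular \<Omega> \<psi> (\<lambda>x. v x /\<^sub>R c) \<le> modular \<Omega> \<psi> (\<lambda>x. v x /\<^sub>R d)"
    using d by (intro modular_mono) (auto intro!: mult_right_mono simp: le_imp_inverse_le)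
  with d show ?thesis by simp
qed

lemma orlicz_ballI:
  assumes "v \<in> L0 \<Omega>" "modular \<Omega> \<psi> v \<le> 1"
  shows "v \<in> orlicz_ball \<Omega> \<psi>"
proof -
  have "modular \<Omega> \<psi> (\<lambda>x. 1 *\<^sub>R v x) < \<infinity>"
    using assms(2) by (auto intro: le_less_trans)
  from orlicz_spaceI[OF assms(1) _ this] show ?thesis
    using lux_norm_le[of 1 v] assms(2) by (simp add: orlicz_ball_def)
qed

lemma zero_in_orlicz_ball: "(\<lambda>x. 0) \<in> orlicz_ball \<Omega> \<psi>"
  by (rule orlicz_ballI) (auto simp: L0_def modular_def zero)

lemma orlicz_ball_subset: "v \<in> orlicz_ball \<Omega> \<psi> \<Longrightarrow> v \<in> orlicz_space \<Omega> \<psi>"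
  and orlicz_ball_lux_norm: "v \<in> orlicz_ball \<Omega> \<psi> \<Longrightarrow> lux_norm \<Omega> \<psi> v \<le> 1"
  by (auto simp: orlicz_ball_def)

text \<open>This makes bounded functionals vanish on fields carried by a null set, hence makes their
  set functions absolutely continuous.\<close>

lemma lux_norm_AE_zero:
  assumes "v \<in> L0 \<Omega>" "AE x in lebesgue_on \<Omega>. v x = 0"
  shows "v \<in> orlicz_space \<Omega> \<psi>" and "lux_norm \<Omega> \<psi> v = 0"
proof -
  have 0: "modular \<Omega> \<psi> (\<lambda>x. c *\<^sub>R v x) = 0" for c
  proof -
    have "modular \<Omega> \<psi> (\<lambda>x. c *\<^sub>R v x) = (\<integral>\<^sup>+x. 0 \<partial>lebesgue_on \<Omega>)"
      unfolding modular_def using assms(2) by (intro nn_integral_cong_AE) (auto simp: zero)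
    then show ?thesis by simp
  qed
  show v: "v \<in> orlicz_space \<Omega> \<psi>"
    using 0[of 1] assms(1) by (intro orlicz_spaceI[of v 1]) auto
  have "lux_norm \<Omega> \<psi> v \<le> 0 + e" if "e > 0" for e
    using that 0 by (intro order_trans[OF lux_norm_le[of e]]) auto
  then have "lux_norm \<Omega> \<psi> v \<le> 0"
    by (rule field_le_epsilon)
  with lux_norm_nonneg[OF v] show "lux_norm \<Omega> \<psi> v = 0" by simp
qed

end

section \<open>The conjugate integrand and order continuity\<close>

text \<open>For nonnegative t, rounding down to the mesh \<open>1 / (n + 1)\<close>. That there are
  countably many values serves measurability of compositions; that they are rational serves the
  countable supremum for the conjugate.\<close>

definition grid :: "nat \<Rightarrow> real \<Rightarrow> real" where
  "grid n t = real (nat \<lfloor>real (Suc n) * t\<rfloor>) / real (Suc n)"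

lemma grid_nonneg: "0 \<le> grid n t"
  by (simp add: grid_def)

lemma grid_tendsto:
  assumes "0 \<le> t"
  shows "(\<lambda>n. grid n t) \<longlonglongrightarrow> t"
proof (rule LIMSEQ_I)
  fix e :: real assume "0 < e"
  then obtain N where N: "inverse (real (Suc N)) < e"
    using reals_Archimedean by auto
  have "norm (grid n t - t) < e" if "N \<le> n" for n
  proof -
    have "real (nat \<lfloor>real (Suc n) * t\<rfloor>) = of_int \<lfloor>real (Suc n) * t\<rfloor>"
      using assms by (simp add: of_nat_nat)
    then have "\<bar>real (nat \<lfloor>real (Suc n) * t\<rfloor>) - real (Suc n) * t\<bar> \<le> 1"
      by linarith
    moreover have "grid n t - t = (real (nat \<lfloor>real (Suc n) * t\<rfloor>) - real (Suc n) * t) / real (Suc n)"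
      by (simp add: grid_def diff_divide_distrib del: of_nat_Suc)
    ultimately have "norm (grid n t - t) \<le> 1 / real (Suc n)"
      by (simp add: divide_right_mono del: of_nat_Suc)
    also have "\<dots> \<le> inverse (real (Suc N))"
      using that by (simp add: inverse_eq_divide frac_le)
    finally show ?thesis using N by simp
  qed
  then show "\<exists>N. \<forall>n\<ge>N. norm (grid n t - t) < e" by blast
qed

text \<open>After rounding g to the grid, the composition is pieced together from countably many
  measurable slices of f; continuity in the second variable lets the mesh tend to 0.\<close>

lemma borel_measurable_Caratheodory:
  fixes f :: "'a \<Rightarrow> real \<Rightarrow> real"
  assumes meas: "\<And>t. 0 \<le> t \<Longrightarrow> (\<lambda>x. f x t) \<in> borel_measurable M"
    and cont: "\<And>x. continuous_on {0..} (f x)"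
    and g[measurable]: "g \<in> borel_measurable M" and nonneg: "\<And>x. 0 \<le> g x"
  shows "(\<lambda>x. f x (g x)) \<in> borel_measurable M"
proof (rule borel_measurable_LIMSEQ_real)
  show "(\<lambda>n. f x (grid n (g x))) \<longlonglongrightarrow> f x (g x)" for x
    using continuous_on_tendsto_compose[OF cont grid_tendsto[OF nonneg]] nonneg grid_nonneg by auto
  show "(\<lambda>x. f x (grid n (g x))) \<in> borel_measurable M" for n
    unfolding grid_def
    by (rule measurable_compose_countable[where f="\<lambda>k x. f x (real k / real (Suc n))"])
      (auto intro!: meas)
qed

section \<open>The pointwise conjugate as a countable supremum\<close>

lemma conjugate_le_iff:
  "conjugate \<phi> x s \<le> c \<longleftrightarrow> (\<forall>t\<ge>0. ennreal (s * t - \<phi> x t) \<le> c)"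
proof -
  \<comment> \<open>Clipping a negative a to 0 does not affect the comparison, since c is
    nonnegative.\<close>
  have e2: "e2ennreal a \<le> c \<longleftrightarrow> a \<le> enn2ereal c" for a
  proof (cases "0 \<le> a")
    case True
    then show ?thesis by (simp add: less_eq_ennreal.rep_eq enn2ereal_e2ennreal)
  next
    case False
    then show ?thesis
      using order_trans[of a 0 "enn2ereal c"] by (simp add: e2ennreal_neg)
  qed
  have "ereal y \<le> enn2ereal c \<longleftrightarrow> ennreal y \<le> c" for y
    using e2[of "ereal y"] by simp
  then show ?thesis
    by (simp add: conjugate_def e2 SUP_le_iff Ball_def)
qed

lemma conjugate_ge: "0 \<le> t \<Longrightarrow> ennreal (s * t - \<phi> x t) \<le> conjugate \<phi> x s"
  using conjugate_le_iff[of \<phi> x s "conjugate \<phi> x s"] by simp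

lemma Young:
  assumes "0 \<le> t" "0 \<le> \<phi> x t"
  shows "ennreal (s * t) \<le> conjugate \<phi> x s + ennreal (\<phi> x t)"
proof -
  have "ennreal (s * t) = ennreal ((s * t - \<phi> x t) + \<phi> x t)" by simp
  also have "\<dots> \<le> ennreal (s * t - \<phi> x t) + ennreal (\<phi> x t)"
    using assms by (auto simp: ennreal_plus_if simp del: ennreal_plus intro: ennreal_leI)
  also have "\<dots> \<le> conjugate \<phi> x s + ennreal (\<phi> x t)"
    by (intro add_right_mono conjugate_ge assms)
  finally show ?thesis .
qed

definition nonneg_rat :: "nat \<Rightarrow> real" where
  "nonneg_rat n = \<bar>real_of_rat (nat_to_rat_surj n)\<bar>"

lemma nonneg_rat_nonneg: "0 \<le> nonneg_rat n"
  by (simp add: nonneg_rat_def)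

lemma grid_in_range_nonneg_rat: "\<exists>k. grid n t = nonneg_rat k"
proof -
  obtain k where "of_nat (nat \<lfloor>real (Suc n) * t\<rfloor>) / of_nat (Suc n) = nat_to_rat_surj k"
    using surjD[OF surj_nat_to_rat_surj] by blast
  then have "real_of_rat (nat_to_rat_surj k) = grid n t"
    by (metis grid_def of_rat_divide of_rat_of_nat_eq)
  then show ?thesis
    using grid_nonneg[of n t] by (metis abs_of_nonneg nonneg_rat_def)
qed

text \<open>The grid values of any t are rational and their gains converge to the gain at t by
  continuity. A countable supremum is what makes the conjugate measurable in x.\<close>

lemma conjugate_eq_SUP_rat:
  assumes "continuous_on {0..} (\<phi> x)"
  shows "conjugate \<phi> x s = (SUP n. ennreal (s * nonneg_rat n - \<phi> x (nonneg_rat n)))"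
proof (rule antisym)
  show "conjugate \<phi> x s \<le> (SUP n. ennreal (s * nonneg_rat n - \<phi> x (nonneg_rat n)))" (is "_ \<le> ?S")
    unfolding conjugate_le_iff
  proof safe
    fix t :: real assume t: "0 \<le> t"
    have "(\<lambda>n. \<phi> x (grid n t)) \<longlonglongrightarrow> \<phi> x t"
      using continuous_on_tendsto_compose[OF assms grid_tendsto[OF t]] t grid_nonneg by auto
    then have lim: "(\<lambda>n. ennreal (s * grid n t - \<phi> x (grid n t))) \<longlonglongrightarrow> ennreal (s * t - \<phi> x t)"
      by (intro tendsto_ennrealI tendsto_intros grid_tendsto t)
    show "ennreal (s * t - \<phi> x t) \<le> ?S"
    proof (rule LIMSEQ_le_const2[OF lim], intro exI allI impI)
      fix n
      obtain k where "grid n t = nonneg_rat k"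
        using grid_in_range_nonneg_rat by blast
      then show "ennreal (s * grid n t - \<phi> x (grid n t)) \<le> ?S"
        by (auto intro: SUP_upper)
    qed
  qed
  show "?S \<le> conjugate \<phi> x s"
    by (intro SUP_least conjugate_ge nonneg_rat_nonneg)
qed

text \<open>The conditions are imposed at every x, also outside \<Omega>;
  \<open>musielak_orlicz_representative\<close> produces such an integrand from the almost
  everywhere hypotheses. \<open>C_nonneg\<close> allows the doubling inequality to be
  iterated.\<close>

locale musielak_orlicz =
  fixes \<Omega> :: "(real ^ 'n) set" and \<phi> :: "real ^ 'n \<Rightarrow> real \<Rightarrow> real" and C :: real
  assumes lmeasurable: "\<Omega> \<in> lmeasurable"
    and \<phi>_nonneg: "0 \<le> t \<Longrightarrow> 0 \<le> \<phi> x t"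
    and \<phi>_zero: "\<phi> x 0 = 0"
    and \<phi>_mono: "mono_on {0..} (\<phi> x)"
    and \<phi>_convex: "convex_on {0..} (\<phi> x)"
    and \<phi>_continuous: "continuous_on {0..} (\<phi> x)"
    and \<phi>_integrable: "0 \<le> t \<Longrightarrow> integrable (lebesgue_on \<Omega>) (\<lambda>x. \<phi> x t)"
    and C_nonneg: "0 \<le> C"
    and doubling: "0 \<le> t \<Longrightarrow> \<phi> x (2 * t) \<le> C * \<phi> x t"
begin

abbreviation "\<Phi> \<equiv> \<lambda>x t. ennreal (\<phi> x t)"

lemma \<phi>_comp_measurable:
  assumes "g \<in> borel_measurable (lebesgue_on \<Omega>)" "\<And>x. 0 \<le> g x"
  shows "(\<lambda>x. \<phi> x (g x)) \<in> borel_measurable (lebesgue_on \<Omega>)"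
  by (rule borel_measurable_Caratheodory[where f=\<phi>])
    (use \<phi>_integrable \<phi>_continuous assms in \<open>auto simp: borel_measurable_integrable\<close>)

sublocale primal: convex_integrand \<Omega> \<Phi>
proof
  show "(\<lambda>x. ennreal (\<phi> x (norm (v x)))) \<in> borel_measurable (lebesgue_on \<Omega>)" if "v \<in> L0 \<Omega>" for v
    using that \<phi>_comp_measurable[of "\<lambda>x. norm (v x)"] by (auto simp: L0_def)
  show "ennreal (\<phi> x s) \<le> ennreal (\<phi> x t)" if "0 \<le> s" "s \<le> t" for s t x
    using that \<phi>_mono[of x] by (auto simp: mono_on_def intro!: ennreal_leI)
  show "ennreal (\<phi> x (a * s + b * t)) \<le> ennreal a * ennreal (\<phi> x s) + ennreal b * ennreal (\<phi> x t)"
    if *: "0 \<le> s" "0 \<le> t" "0 \<le> a" "0 \<le> b" "a + b = 1" for s t a b x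
  proof -
    have "\<phi> x (a * s + b * t) \<le> a * \<phi> x s + b * \<phi> x t"
      using \<phi>_convex[of x] * by (auto simp: convex_on_def)
    then have "ennreal (\<phi> x (a * s + b * t)) \<le> ennreal (a * \<phi> x s + b * \<phi> x t)"
      by (rule ennreal_leI)
    also have "\<dots> = ennreal a * ennreal (\<phi> x s) + ennreal b * ennreal (\<phi> x t)"
      using * \<phi>_nonneg by (simp add: ennreal_mult)
    finally show ?thesis .
  qed
qed (simp add: \<phi>_zero)

text \<open>The conjugate is a supremum of the affine functions \<open>s * r - \<phi> x r\<close> of
  s with slopes \<open>r \<ge> 0\<close>, clipped at 0; this gives monotonicity and
  convexity.\<close>

sublocale dual: convex_integrand \<Omega> "conjugate \<phi>"
proof
  show "(\<lambda>x. conjugate \<phi> x (norm (v x))) \<in> borel_measurable (lebesgue_on \<Omega>)" if "v \<in> L0 \<Omega>" for v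
  proof -
    have [measurable]: "v \<in> borel_measurable (lebesgue_on \<Omega>)"
      using that by (simp add: L0_def)
    have [measurable]: "(\<lambda>x. \<phi> x (nonneg_rat n)) \<in> borel_measurable (lebesgue_on \<Omega>)" for n
      using \<phi>_integrable[OF nonneg_rat_nonneg] by auto
    show ?thesis
      unfolding conjugate_eq_SUP_rat[OF \<phi>_continuous] by measurable
  qed
  show "conjugate \<phi> x 0 = 0" for x
  proof -
    have "conjugate \<phi> x 0 \<le> 0"
      unfolding conjugate_le_iff using \<phi>_nonneg by (auto simp: ennreal_neg)
    then show ?thesis by simp
  qed
  show "conjugate \<phi> x s \<le> conjugate \<phi> x t" if "0 \<le> s" "s \<le> t" for s t x
    unfolding conjugate_le_iff[of \<phi> x s]
  proof safe
    fix r :: real assume "0 \<le> r"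
    then have "ennreal (s * r - \<phi> x r) \<le> ennreal (t * r - \<phi> x r)"
      using that by (intro ennreal_leI diff_right_mono mult_right_mono)
    also have "\<dots> \<le> conjugate \<phi> x t"
      using \<open>0 \<le> r\<close> by (rule conjugate_ge)
    finally show "ennreal (s * r - \<phi> x r) \<le> conjugate \<phi> x t" .
  qed
  show "conjugate \<phi> x (a * s + b * t) \<le> ennreal a * conjugate \<phi> x s + ennreal b * conjugate \<phi> x t"
    if *: "0 \<le> s" "0 \<le> t" "0 \<le> a" "0 \<le> b" "a + b = 1" for s t a b x
    unfolding conjugate_le_iff[of \<phi> x "a * s + b * t"]
  proof safe
    fix r :: real assume r: "0 \<le> r"
    have "(a * s + b * t) * r - (a + b) * \<phi> x r = a * (s * r - \<phi> x r) + b * (t * r - \<phi> x r)"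
      by (simp add: algebra_simps)
    then have "ennreal ((a * s + b * t) * r - \<phi> x r) = ennreal (a * (s * r - \<phi> x r) + b * (t * r - \<phi> x r))"
      using * by simp
    also have "\<dots> \<le> ennreal (a * (s * r - \<phi> x r)) + ennreal (b * (t * r - \<phi> x r))"
      by (auto simp: ennreal_plus_if simp del: ennreal_plus intro: ennreal_leI)
    also have "\<dots> = ennreal a * ennreal (s * r - \<phi> x r) + ennreal b * ennreal (t * r - \<phi> x r)"
      using * by (simp add: ennreal_mult')
    also have "\<dots> \<le> ennreal a * conjugate \<phi> x s + ennreal b * conjugate \<phi> x t"
      using r by (intro add_mono mult_left_mono conjugate_ge) auto
    finally show "ennreal ((a * s + b * t) * r - \<phi> x r)
        \<le> ennreal a * conjugate \<phi> x s + ennreal b * conjugate \<phi> x t" .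
  qed
qed

section \<open>Consequences of the doubling condition\<close>

lemma doubling_power: "0 \<le> t \<Longrightarrow> \<phi> x (2 ^ k * t) \<le> C ^ k * \<phi> x t"
proof (induction k)
  case (Suc k)
  have "\<phi> x (2 ^ Suc k * t) \<le> C * \<phi> x (2 ^ k * t)"
    using doubling[of "2 ^ k * t" x] Suc.prems by (simp add: mult.assoc)
  also have "\<dots> \<le> C * (C ^ k * \<phi> x t)"
    using Suc C_nonneg by (intro mult_left_mono) auto
  finally show ?case by (simp add: mult.assoc)
qed simp

lemma modular_scaleR_finite:
  assumes "v \<in> orlicz_space \<Omega> \<Phi>"
  shows "modular \<Omega> \<Phi> (\<lambda>x. a *\<^sub>R v x) < \<infinity>"
proof -
  let ?\<rho> = "modular \<Omega> \<Phi>"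
  obtain c where c: "c > 0" "?\<rho> (\<lambda>x. c *\<^sub>R v x) < \<infinity>"
    using assms by (auto simp: orlicz_space_def)
  \<comment> \<open>Enough doublings to pass from the scale c, where the modular is finite, to
    \<open>\<bar>a\<bar>\<close>; they cost the factor \<open>C ^ k\<close>.\<close>
  obtain k where k: "\<bar>a\<bar> / c < 2 ^ k"
    using real_arch_pow[of 2 "\<bar>a\<bar> / c"] by auto
  have le: "\<bar>a\<bar> \<le> 2 ^ k * c"
    using k c by (simp add: field_simps)
  have "?\<rho> (\<lambda>x. a *\<^sub>R v x) \<le> ?\<rho> (\<lambda>x. (2 ^ k * c) *\<^sub>R v x)"
    using c mult_right_mono[OF le norm_ge_zero] by (intro primal.modular_mono) (auto simp: abs_mult)
  also have "\<dots> \<le> (\<integral>\<^sup>+x. ennreal (C ^ k) * ennreal (\<phi> x (norm (c *\<^sub>R v x))) \<partial>lebesgue_on \<Omega>)"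
    unfolding modular_def
  proof (intro nn_integral_mono)
    fix x
    have "\<phi> x (2 ^ k * norm (c *\<^sub>R v x)) \<le> C ^ k * \<phi> x (norm (c *\<^sub>R v x))"
      by (intro doubling_power) simp
    moreover have "norm ((2 ^ k * c) *\<^sub>R v x) = 2 ^ k * norm (c *\<^sub>R v x)"
      by (simp add: abs_mult)
    ultimately show "ennreal (\<phi> x (norm ((2 ^ k * c) *\<^sub>R v x)))
        \<le> ennreal (C ^ k) * ennreal (\<phi> x (norm (c *\<^sub>R v x)))"
      using C_nonneg by (metis ennreal_leI ennreal_mult' zero_le_power)
  qed
  also have "\<dots> = ennreal (C ^ k) * ?\<rho> (\<lambda>x. c *\<^sub>R v x)"
    unfolding modular_def
    using primal.measurable_comp[OF primal.L0_scaleR[OF primal.orlicz_space_L0[OF assms]]]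
    by (rule nn_integral_cmult)
  also have "\<dots> < \<infinity>"
    using c by (simp add: ennreal_mult_less_top)
  finally show ?thesis .
qed

lemma modular_bounded_finite:
  assumes "\<And>x. x \<in> \<Omega> \<Longrightarrow> norm (v x) \<le> B"
  shows "modular \<Omega> \<Phi> v < \<infinity>"
proof -
  \<comment> \<open>The constant level \<open>\<bar>B\<bar>\<close> has integrable \<phi>. The
    absolute value covers a negative B, which is possible only for empty \<Omega>.\<close>
  have "modular \<Omega> \<Phi> v \<le> (\<integral>\<^sup>+x. ennreal (\<phi> x \<bar>B\<bar>) \<partial>lebesgue_on \<Omega>)"
    unfolding modular_def using assms
    by (intro nn_integral_mono primal.mono) (auto intro: order_trans[OF _ abs_ge_self])
  also have "\<dots> < \<infinity>"
    using \<phi>_integrable[of "\<bar>B\<bar>"] \<phi>_nonneg[of "\<bar>B\<bar>"] by (simp add: nn_integral_eq_integral)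
  finally show ?thesis .
qed

lemma bounded_in_orlicz_space:
  assumes "v \<in> L0 \<Omega>" "\<And>x. x \<in> \<Omega> \<Longrightarrow> norm (v x) \<le> B"
  shows "v \<in> orlicz_space \<Omega> \<Phi>"
proof -
  have "modular \<Omega> \<Phi> (\<lambda>x. 1 *\<^sub>R v x) < \<infinity>"
    using assms(2) by (intro modular_bounded_finite[of _ B]) auto
  from primal.orlicz_spaceI[OF assms(1) _ this] show ?thesis by simp
qed

text \<open>Dominated convergence is run at every scale e separately: as soon as the modular of
  \<open>w k / e\<close> drops below 1, the norm of \<open>w k\<close> is at most e. The majorant,
  the integrand of \<open>v / e\<close>, is integrable for each e by doubling.\<close>

lemma lux_norm_tendsto_zero:
  assumes v: "v \<in> orlicz_space \<Omega> \<Phi>"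
    and w: "\<And>k::nat. w k \<in> L0 \<Omega>"
    and le: "\<And>k. AE x in lebesgue_on \<Omega>. norm (w k x) \<le> norm (v x)"
    and lim: "AE x in lebesgue_on \<Omega>. (\<lambda>k. w k x) \<longlonglongrightarrow> 0"
  shows "(\<lambda>k. lux_norm \<Omega> \<Phi> (w k)) \<longlonglongrightarrow> 0"
proof -
  let ?\<rho> = "modular \<Omega> \<Phi>" and ?n = "lux_norm \<Omega> \<Phi>"
  have w_space: "w k \<in> orlicz_space \<Omega> \<Phi>" for k
    using primal.orlicz_space_mono[OF v w le] .
  have *: "\<forall>\<^sub>F k in sequentially. ?n (w k) \<le> e" if e: "0 < e" for e
  proof -
    have "(\<lambda>k. ?\<rho> (\<lambda>x. w k x /\<^sub>R e)) \<longlonglongrightarrow> (\<integral>\<^sup>+x. 0 \<partial>lebesgue_on \<Omega>)"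
      unfolding modular_def
    proof (rule nn_integral_dominated_convergence[where w="\<lambda>x. ennreal (\<phi> x (norm (v x /\<^sub>R e)))"])
      show "(\<lambda>x. ennreal (\<phi> x (norm (w k x /\<^sub>R e)))) \<in> borel_measurable (lebesgue_on \<Omega>)" for k
        by (rule primal.measurable_comp[OF primal.L0_scaleR[OF w]])
      show "(\<lambda>x. ennreal (\<phi> x (norm (v x /\<^sub>R e)))) \<in> borel_measurable (lebesgue_on \<Omega>)"
        by (rule primal.measurable_comp[OF primal.L0_scaleR[OF primal.orlicz_space_L0[OF v]]])
      show "AE x in lebesgue_on \<Omega>. ennreal (\<phi> x (norm (w k x /\<^sub>R e))) \<le> ennreal (\<phi> x (norm (v x /\<^sub>R e)))" for k
        using le[of k] e by (auto elim!: eventually_mono intro!: primal.mono mult_left_mono)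
      show "(\<integral>\<^sup>+x. ennreal (\<phi> x (norm (v x /\<^sub>R e))) \<partial>lebesgue_on \<Omega>) < \<infinity>"
        using modular_scaleR_finite[OF v] by (simp only: modular_def)
      show "AE x in lebesgue_on \<Omega>. (\<lambda>k. ennreal (\<phi> x (norm (w k x /\<^sub>R e)))) \<longlonglongrightarrow> 0"
        using lim
      proof eventually_elim
        case (elim x)
        have "(\<lambda>k. norm (w k x /\<^sub>R e)) \<longlonglongrightarrow> norm ((0::real^'n) /\<^sub>R e)"
          by (intro tendsto_intros elim)
        then have "(\<lambda>k. norm (w k x /\<^sub>R e)) \<longlonglongrightarrow> 0"
          by simp
        then have "(\<lambda>k. \<phi> x (norm (w k x /\<^sub>R e))) \<longlonglongrightarrow> \<phi> x 0"
          by (intro continuous_on_tendsto_compose[OF \<phi>_continuous]) auto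
        then show ?case
          using tendsto_ennrealI by (fastforce simp: \<phi>_zero)
      qed
    qed simp
    then have "\<forall>\<^sub>F k in sequentially. ?\<rho> (\<lambda>x. w k x /\<^sub>R e) < 1"
      by (intro order_tendstoD) auto
    then show ?thesis
      using e by (auto elim!: eventually_mono intro!: primal.lux_norm_le)
  qed
  show ?thesis
  proof (rule order_tendstoI)
    fix a :: real assume "a < 0"
    then show "\<forall>\<^sub>F k in sequentially. a < ?n (w k)"
      using primal.lux_norm_nonneg[OF w_space] by (intro always_eventually) (auto intro: less_le_trans)
  next
    fix a :: real assume "0 < a"
    then show "\<forall>\<^sub>F k in sequentially. ?n (w k) < a"
      using *[of "a / 2"] by (auto elim!: eventually_mono)
  qed
qed

end

section \<open>Young duality\<close>

lemma inner_sgn_self: "x \<bullet> sgn x = norm (x :: 'a :: real_inner)"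
  by (cases "x = 0") (simp_all add: sgn_div_norm power2_norm_eq_inner[symmetric] power2_eq_square)

text \<open>Keeps the best of 0 and the first n enumerated nonnegative rationals for the gain
  \<open>s * t - f t\<close>; ties keep the earlier choice. Each step is one comparison, so the
  choice stays measurable in parameters, and starting from 0 makes all gains nonnegative when
  \<open>f 0 = 0\<close>.\<close>

primrec greedy :: "(real \<Rightarrow> real) \<Rightarrow> real \<Rightarrow> nat \<Rightarrow> real" where
  "greedy f s 0 = 0"
| "greedy f s (Suc n) =
    (if s * greedy f s n - f (greedy f s n) < s * nonneg_rat n - f (nonneg_rat n)
     then nonneg_rat n else greedy f s n)"

lemma greedy_nonneg: "0 \<le> greedy f s n"
  by (induction n) (auto simp: nonneg_rat_nonneg)

text \<open>For fixed n the values lie in a finite list that depends on neither f nor s. This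
  uniformity is what makes the competitors bounded fields.\<close>

lemma greedy_bounded: "\<exists>B. \<forall>f s. greedy f s n \<le> B"
proof (induction n)
  case (Suc n)
  then obtain B where "\<And>f s. greedy f s n \<le> B" by blast
  then show ?case
    by (intro exI[of _ "max B (nonneg_rat n)"]) (auto intro: max.coboundedI1)
qed auto

lemma greedy_value_incseq: "incseq (\<lambda>n. s * greedy f s n - f (greedy f s n))"
  by (rule incseq_SucI) auto

text \<open>The same supremum as over the rationals, but along an increasing sequence, as monotone
  convergence requires.\<close>

lemma conjugate_eq_SUP_greedy:
  assumes "continuous_on {0..} (\<phi> x)"
  shows "conjugate \<phi> x s = (SUP n. ennreal (s * greedy (\<phi> x) s n - \<phi> x (greedy (\<phi> x) s n)))"
proof (rule antisym)
  \<comment> \<open>The n-th rational enters the comparison in step \<open>Suc n\<close>.\<close>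
  have "ennreal (s * nonneg_rat n - \<phi> x (nonneg_rat n))
      \<le> ennreal (s * greedy (\<phi> x) s (Suc n) - \<phi> x (greedy (\<phi> x) s (Suc n)))" for n
    by (intro ennreal_leI) auto
  then show "conjugate \<phi> x s \<le> (SUP n. ennreal (s * greedy (\<phi> x) s n - \<phi> x (greedy (\<phi> x) s n)))"
    unfolding conjugate_eq_SUP_rat[where \<phi>=\<phi> and x=x, OF assms] by (blast intro: SUP_mono)
  show "(SUP n. ennreal (s * greedy (\<phi> x) s n - \<phi> x (greedy (\<phi> x) s n))) \<le> conjugate \<phi> x s"
    by (intro SUP_least conjugate_ge greedy_nonneg)
qed

context musielak_orlicz
begin

text \<open>Young's inequality is applied to \<open>p / b\<close> and \<open>v / a\<close> with a
  and b strictly above the norms. Both modulars are then at most 1, whence the factor 1 + 1, and no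
  division by a vanishing norm occurs.\<close>

lemma Hoelder:
  assumes p: "p \<in> orlicz_space \<Omega> (conjugate \<phi>)" and v: "v \<in> orlicz_space \<Omega> \<Phi>"
  shows "(\<integral>\<^sup>+x. ennreal \<bar>p x \<bullet> v x\<bar> \<partial>lebesgue_on \<Omega>)
    \<le> ennreal (2 * lux_norm \<Omega> (conjugate \<phi>) p * lux_norm \<Omega> \<Phi> v)" (is "?I \<le> ennreal (2 * ?P * ?V)")
proof -
  have pos: "0 \<le> ?P" "0 \<le> ?V"
    using primal.lux_norm_nonneg[OF v] dual.lux_norm_nonneg[OF p] by auto
  have *: "?I \<le> ennreal (2 * b * a)" if b: "?P < b" and a: "?V < a" for a b
  proof -
    have ab: "0 < a" "0 < b" using a b pos by auto
    have "ennreal \<bar>p x \<bullet> v x\<bar>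
        \<le> ennreal (b * a) * (conjugate \<phi> x (norm (p x /\<^sub>R b)) + ennreal (\<phi> x (norm (v x /\<^sub>R a))))" for x
    proof -
      have "\<bar>p x \<bullet> v x\<bar> \<le> norm (p x) * norm (v x)"
        by (rule Cauchy_Schwarz_ineq2)
      also have "\<dots> = (b * a) * (norm (p x /\<^sub>R b) * norm (v x /\<^sub>R a))"
        using ab by (simp add: field_simps)
      finally have "ennreal \<bar>p x \<bullet> v x\<bar> \<le> ennreal ((b * a) * (norm (p x /\<^sub>R b) * norm (v x /\<^sub>R a)))"
        by (rule ennreal_leI)
      also have "\<dots> = ennreal (b * a) * ennreal (norm (p x /\<^sub>R b) * norm (v x /\<^sub>R a))"
        using ab by (intro ennreal_mult') simp
      also have "\<dots> \<le> ennreal (b * a) * (conjugate \<phi> x (norm (p x /\<^sub>R b)) + ennreal (\<phi> x (norm (v x /\<^sub>R a))))"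
        by (intro mult_left_mono Young \<phi>_nonneg) auto
      finally show ?thesis .
    qed
    then have "?I \<le> (\<integral>\<^sup>+x. ennreal (b * a) * (conjugate \<phi> x (norm (p x /\<^sub>R b)) + ennreal (\<phi> x (norm (v x /\<^sub>R a)))) \<partial>lebesgue_on \<Omega>)"
      by (intro nn_integral_mono)
    also have "\<dots> = ennreal (b * a) * (modular \<Omega> (conjugate \<phi>) (\<lambda>x. p x /\<^sub>R b) + modular \<Omega> \<Phi> (\<lambda>x. v x /\<^sub>R a))"
    proof -
      note [measurable] =
        dual.measurable_comp[OF dual.L0_scaleR[OF dual.orlicz_space_L0[OF p]], of "inverse b"]
        primal.measurable_comp[OF primal.L0_scaleR[OF primal.orlicz_space_L0[OF v]], of "inverse a"]
      show ?thesis
        unfolding modular_def by (simp add: nn_integral_cmult nn_integral_add del: norm_scaleR)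
    qed
    also have "\<dots> \<le> ennreal (b * a) * (1 + 1)"
      using dual.modular_le_1_if_lux_norm_less[OF p b] primal.modular_le_1_if_lux_norm_less[OF v a]
      by (intro mult_left_mono add_mono) auto
    also have "\<dots> = ennreal (b * a) * ennreal 2"
      by simp
    also have "\<dots> = ennreal (2 * b * a)"
      using ab by (subst ennreal_mult[symmetric]) (auto simp: mult_ac)
    finally show ?thesis .
  qed
  \<comment> \<open>Let a and b decrease to the two norms.\<close>
  have "(\<lambda>n. ennreal (2 * (?P + inverse (real (Suc n))) * (?V + inverse (real (Suc n)))))
      \<longlonglongrightarrow> ennreal (2 * (?P + 0) * (?V + 0))"
    by (intro tendsto_ennrealI tendsto_intros LIMSEQ_inverse_real_of_nat)
  then have "?I \<le> ennreal (2 * (?P + 0) * (?V + 0))"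
    by (rule LIMSEQ_le_const) (intro exI allI impI *; simp)
  then show ?thesis by simp
qed

lemma pairing_integrable:
  assumes p: "p \<in> orlicz_space \<Omega> (conjugate \<phi>)" and v: "v \<in> orlicz_space \<Omega> \<Phi>"
  shows "integrable (lebesgue_on \<Omega>) (\<lambda>x. p x \<bullet> v x)"
proof (rule integrableI_bounded)
  have [measurable]: "p \<in> borel_measurable (lebesgue_on \<Omega>)" "v \<in> borel_measurable (lebesgue_on \<Omega>)"
    using dual.orlicz_space_L0[OF p] primal.orlicz_space_L0[OF v] by (auto simp: L0_def)
  show "(\<lambda>x. p x \<bullet> v x) \<in> borel_measurable (lebesgue_on \<Omega>)"
    by measurable
  show "(\<integral>\<^sup>+x. ennreal (norm (p x \<bullet> v x)) \<partial>lebesgue_on \<Omega>) < \<infinity>"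
    using le_less_trans[OF Hoelder[OF p v] ennreal_less_top] by simp
qed

lemma abs_pairing_le:
  assumes p: "p \<in> orlicz_space \<Omega> (conjugate \<phi>)" and v: "v \<in> orlicz_space \<Omega> \<Phi>"
  shows "\<bar>pairing \<Omega> p v\<bar> \<le> 2 * lux_norm \<Omega> (conjugate \<phi>) p * lux_norm \<Omega> \<Phi> v"
proof -
  have "ennreal \<bar>pairing \<Omega> p v\<bar> \<le> (\<integral>\<^sup>+x. ennreal \<bar>p x \<bullet> v x\<bar> \<partial>lebesgue_on \<Omega>)"
    using integral_norm_bound_ennreal[OF pairing_integrable[OF p v]] by (simp add: pairing_def)
  also note Hoelder[OF p v]
  finally show ?thesis
    using primal.lux_norm_nonneg[OF v] dual.lux_norm_nonneg[OF p] by simp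
qed

text \<open>Pairing p with this bounded field gives the integral of \<open>norm (p x)\<close>: the
  source of integrability and of uniqueness of the representing field.\<close>

lemma sgn_in_orlicz_space:
  assumes "p \<in> L0 \<Omega>"
  shows "(\<lambda>x. sgn (p x)) \<in> orlicz_space \<Omega> \<Phi>"
proof (rule bounded_in_orlicz_space[where B=1])
  have [measurable]: "p \<in> borel_measurable (lebesgue_on \<Omega>)"
    using assms by (simp add: L0_def)
  show "(\<lambda>x. sgn (p x)) \<in> L0 \<Omega>"
    unfolding L0_def sgn_div_norm by measurable
qed (simp add: norm_sgn)

lemma conjugate_space_integrable:
  assumes p: "p \<in> orlicz_space \<Omega> (conjugate \<phi>)"
  shows "integrable (lebesgue_on \<Omega>) p"
proof -
  have "integrable (lebesgue_on \<Omega>) (\<lambda>x. norm (p x))"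
    using pairing_integrable[OF p sgn_in_orlicz_space[OF dual.orlicz_space_L0[OF p]]]
    by (simp add: inner_sgn_self)
  moreover have "p \<in> borel_measurable (lebesgue_on \<Omega>)"
    using dual.orlicz_space_L0[OF p] by (simp add: L0_def)
  ultimately show ?thesis
    by (simp add: integrable_norm_iff)
qed

lemma bounded_pairing_integrable:
  assumes q: "integrable (lebesgue_on \<Omega>) q" and v: "v \<in> L0 \<Omega>" "\<And>x. norm (v x) \<le> B"
  shows "integrable (lebesgue_on \<Omega>) (\<lambda>x. q x \<bullet> v x)"
proof (rule Bochner_Integration.integrable_bound)
  show "integrable (lebesgue_on \<Omega>) (\<lambda>x. norm (q x) * B)"
    using q by simp
  have [measurable]: "q \<in> borel_measurable (lebesgue_on \<Omega>)" "v \<in> borel_measurable (lebesgue_on \<Omega>)"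
    using q v by (auto simp: L0_def)
  show "(\<lambda>x. q x \<bullet> v x) \<in> borel_measurable (lebesgue_on \<Omega>)"
    by measurable
  have "norm (q x \<bullet> v x) \<le> norm (norm (q x) * B)" for x
  proof -
    have "norm (q x \<bullet> v x) \<le> norm (q x) * norm (v x)"
      using Cauchy_Schwarz_ineq2 by simp
    also have "\<dots> \<le> norm (q x) * B"
      using v(2) by (intro mult_left_mono) auto
    finally show ?thesis by simp
  qed
  then show "AE x in lebesgue_on \<Omega>. norm (q x \<bullet> v x) \<le> norm (norm (q x) * B)"
    by simp
qed

section \<open>The test argument for the conjugate modular\<close>

lemma greedy_measurable:
  assumes [measurable]: "s \<in> borel_measurable (lebesgue_on \<Omega>)"
  shows "(\<lambda>x. greedy (\<phi> x) (s x) n) \<in> borel_measurable (lebesgue_on \<Omega>)"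
proof (induction n)
  case (Suc n)
  note [measurable] = Suc \<phi>_comp_measurable[OF Suc greedy_nonneg]
    borel_measurable_integrable[OF \<phi>_integrable[OF nonneg_rat_nonneg]]
  show ?case by simp
qed simp

text \<open>
  The competitor \<open>greedy (\<phi> x) \<bar>q x\<bar> n\<close> in the direction of \<open>q x\<close> is an almost optimal, bounded
  choice in the supremum defining \<open>\<phi>\<^sup>*(x, \<bar>q x\<bar>)\<close>. If its modular exceeds 1 it is scaled
  down, which by convexity only costs a factor that the gain \<open>q \<bullet> v - \<phi>(\<cdot>, \<bar>v\<bar>)\<close> absorbs.
\<close>

lemma modular_conjugate_le_1:
  assumes q: "integrable (lebesgue_on \<Omega>) q"
    and test: "\<And>v B. v \<in> L0 \<Omega> \<Longrightarrow> (\<And>x. norm (v x) \<le> B) \<Longrightarrow> modular \<Omega> \<Phi> v \<le> 1 \<Longrightarrow> pairing \<Omega> q v \<le> 1"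
  shows "modular \<Omega> (conjugate \<phi>) q \<le> 1"
proof -
  define t where "t n x = greedy (\<phi> x) (norm (q x)) n" for n x
  define g where "g n x = norm (q x) * t n x - \<phi> x (t n x)" for n x
  have q_meas[measurable]: "q \<in> borel_measurable (lebesgue_on \<Omega>)"
    using q by auto
  have t_meas[measurable]: "t n \<in> borel_measurable (lebesgue_on \<Omega>)" for n
    unfolding t_def by (rule greedy_measurable) simp
  have t_nonneg: "0 \<le> t n x" for n x
    by (simp add: t_def greedy_nonneg)
  have g_meas[measurable]: "g n \<in> borel_measurable (lebesgue_on \<Omega>)" for n
    unfolding g_def using \<phi>_comp_measurable[OF t_meas t_nonneg] by measurable
  have g_inc: "g n x \<le> g (Suc n) x" for n x
    using incseq_SucD[OF greedy_value_incseq] by (simp only: g_def t_def)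
  have g_nonneg: "0 \<le> g n x" for n x
  proof (induction n)
    case 0
    then show ?case by (simp add: g_def t_def \<phi>_zero)
  next
    case (Suc n)
    then show ?case using g_inc order_trans by blast
  qed
  have "(\<integral>\<^sup>+x. ennreal (g n x) \<partial>lebesgue_on \<Omega>) \<le> 1" for n
  proof -
    obtain B where B: "t n x \<le> B" for x
      using greedy_bounded[of n] unfolding t_def by blast
    define v where "v x = t n x *\<^sub>R sgn (q x)" for x
    have v: "v \<in> L0 \<Omega>"
      unfolding L0_def v_def sgn_div_norm by measurable
    \<comment> \<open>An inequality accommodates the zeros of q, where \<open>sgn\<close> is 0;
      monotonicity of \<phi> later turns it in the right direction.\<close>
    have v_le: "norm (v x) \<le> t n x" for x
      using t_nonneg by (simp add: v_def norm_sgn)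
    have v_bd: "norm (v x) \<le> B" for x
      using v_le B order_trans by blast
    define I where "I = (\<integral>x. \<phi> x (norm (v x)) \<partial>lebesgue_on \<Omega>)"
    have int_\<phi>: "integrable (lebesgue_on \<Omega>) (\<lambda>x. \<phi> x (norm (v x)))"
    proof (rule integrableI_bounded)
      show "(\<lambda>x. \<phi> x (norm (v x))) \<in> borel_measurable (lebesgue_on \<Omega>)"
        using v by (intro \<phi>_comp_measurable) (auto simp: L0_def)
      show "(\<integral>\<^sup>+x. ennreal (norm (\<phi> x (norm (v x)))) \<partial>lebesgue_on \<Omega>) < \<infinity>"
        using modular_bounded_finite[OF v_bd] \<phi>_nonneg by (simp add: modular_def)
    qed
    have I: "modular \<Omega> \<Phi> v = ennreal I" "0 \<le> I"
      using int_\<phi> \<phi>_nonneg by (auto simp: modular_def I_def nn_integral_eq_integral)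
    have int_qv: "integrable (lebesgue_on \<Omega>) (\<lambda>x. q x \<bullet> v x)"
      by (rule bounded_pairing_integrable[OF q v v_bd])
    have "pairing \<Omega> q v - I \<le> 1"
    proof (cases "I \<le> 1")
      case True
      then have "pairing \<Omega> q v \<le> 1"
        using I by (intro test[OF v v_bd]) auto
      then show ?thesis using I by simp
    next
      case False
      \<comment> \<open>The test applied to \<open>v / I\<close> bounds the pairing with v by I
        itself, so in this case the difference is even at most 0.\<close>
      have "modular \<Omega> \<Phi> (\<lambda>x. (1 / I) *\<^sub>R v x) \<le> ennreal (1 / I) * ennreal I"
        unfolding I(1)[symmetric] using False by (intro primal.modular_scale_le v) auto
      also have "\<dots> = 1"
        using False by (subst ennreal_mult[symmetric]) auto
      finally have "pairing \<Omega> q (\<lambda>x. (1 / I) *\<^sub>R v x) \<le> 1"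
        using False v_bd
        by (intro test[where B="(1 / I) * B"] primal.L0_scaleR v) (auto simp: divide_right_mono)
      then have "pairing \<Omega> q v / I \<le> 1"
        by (simp add: pairing_def)
      then show ?thesis using False by (simp add: field_simps)
    qed
    then have le_1: "(\<integral>x. q x \<bullet> v x - \<phi> x (norm (v x)) \<partial>lebesgue_on \<Omega>) \<le> 1"
      using int_\<phi> int_qv by (simp add: pairing_def I_def)
    have g_le: "g n x \<le> q x \<bullet> v x - \<phi> x (norm (v x))" for x
    proof -
      have "q x \<bullet> v x = norm (q x) * t n x"
        by (simp add: v_def inner_sgn_self)
      moreover have "\<phi> x (norm (v x)) \<le> \<phi> x (t n x)"
        using \<phi>_mono[of x] v_le t_nonneg by (auto simp: mono_on_def)
      ultimately show ?thesis by (simp add: g_def)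
    qed
    then have "(\<integral>\<^sup>+x. ennreal (g n x) \<partial>lebesgue_on \<Omega>)
        \<le> (\<integral>\<^sup>+x. ennreal (q x \<bullet> v x - \<phi> x (norm (v x))) \<partial>lebesgue_on \<Omega>)"
      by (intro nn_integral_mono ennreal_leI)
    also have "\<dots> = ennreal (\<integral>x. q x \<bullet> v x - \<phi> x (norm (v x)) \<partial>lebesgue_on \<Omega>)"
      using int_\<phi> int_qv order_trans[OF g_nonneg g_le]
      by (intro nn_integral_eq_integral AE_I2) simp_all
    also have "\<dots> \<le> 1"
      using le_1 by simp
    finally show ?thesis .
  qed
  then have "(SUP n. \<integral>\<^sup>+x. ennreal (g n x) \<partial>lebesgue_on \<Omega>) \<le> 1"
    by (intro SUP_least)
  moreover have "modular \<Omega> (conjugate \<phi>) q = (\<integral>\<^sup>+x. (SUP n. ennreal (g n x)) \<partial>lebesgue_on \<Omega>)"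
    by (simp add: modular_def conjugate_eq_SUP_greedy[OF \<phi>_continuous] g_def t_def)
  moreover have "\<dots> = (SUP n. \<integral>\<^sup>+x. ennreal (g n x) \<partial>lebesgue_on \<Omega>)"
    using g_inc by (intro nn_integral_monotone_convergence_SUP incseq_SucI le_funI ennreal_leI) auto
  ultimately show ?thesis by simp
qed

text \<open>Homogeneous form of the test: it is applied to \<open>p / e\<close> for every
  \<open>e > K\<close>, which keeps the divisor positive even for \<open>K = 0\<close>, and then e
  decreases to K.\<close>

lemma lux_norm_conjugate_le:
  assumes p: "integrable (lebesgue_on \<Omega>) p" and K: "0 \<le> K"
    and test: "\<And>v B. v \<in> L0 \<Omega> \<Longrightarrow> (\<And>x. norm (v x) \<le> B) \<Longrightarrow> modular \<Omega> \<Phi> v \<le> 1 \<Longrightarrow> pairing \<Omega> p v \<le> K"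
  shows "p \<in> orlicz_space \<Omega> (conjugate \<phi>)" and "lux_norm \<Omega> (conjugate \<phi>) p \<le> K"
proof -
  have *: "modular \<Omega> (conjugate \<phi>) (\<lambda>x. p x /\<^sub>R e) \<le> 1" if e: "K < e" for e
  proof (rule modular_conjugate_le_1)
    show "integrable (lebesgue_on \<Omega>) (\<lambda>x. p x /\<^sub>R e)"
      using p by simp
    fix v :: "real ^ 'n \<Rightarrow> real ^ 'n" and B
    assume "v \<in> L0 \<Omega>" "\<And>x. norm (v x) \<le> B" "modular \<Omega> \<Phi> v \<le> 1"
    then have "pairing \<Omega> p v \<le> K" by (rule test)
    then have "pairing \<Omega> p v / e \<le> 1"
      using K e by (simp add: field_simps)
    then show "pairing \<Omega> (\<lambda>x. p x /\<^sub>R e) v \<le> 1"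
      by (simp add: pairing_def divide_inverse mult.commute)
  qed
  have "p \<in> L0 \<Omega>"
    using p by (simp add: L0_def borel_measurable_integrable)
  then show "p \<in> orlicz_space \<Omega> (conjugate \<phi>)"
    by (rule dual.orlicz_spaceI[where c="inverse (K + 1)"])
      (use K *[of "K + 1"] in \<open>auto intro: le_less_trans\<close>)
  have "lux_norm \<Omega> (conjugate \<phi>) p \<le> K + e" if "0 < e" for e
    using that K * by (intro dual.lux_norm_le) auto
  then show "lux_norm \<Omega> (conjugate \<phi>) p \<le> K"
    by (rule field_le_epsilon)
qed

end

section \<open>Representation of bounded functionals\<close>

context musielak_orlicz
begin

lemma
  assumes F: "F \<in> norm_dual \<Omega> \<Phi>" and u: "u \<in> orlicz_space \<Omega> \<Phi>"
  shows norm_dual_add: "v \<in> orlicz_space \<Omega> \<Phi> \<Longrightarrow> F (\<lambda>x. u x + v x) = F u + F v"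
    and norm_dual_diff: "v \<in> orlicz_space \<Omega> \<Phi> \<Longrightarrow> F (\<lambda>x. u x - v x) = F u - F v"
    and norm_dual_scaleR: "F (\<lambda>x. a *\<^sub>R u x) = a * F u"
proof -
  have lin: "F (\<lambda>x. a *\<^sub>R u x + b *\<^sub>R v x) = a * F u + b * F v" if "v \<in> orlicz_space \<Omega> \<Phi>" for v a b
    using F u that by (simp add: norm_dual_def)
  show "F (\<lambda>x. u x + v x) = F u + F v" if "v \<in> orlicz_space \<Omega> \<Phi>"
    using lin[OF that, of 1 1] by simp
  show "F (\<lambda>x. u x - v x) = F u - F v" if "v \<in> orlicz_space \<Omega> \<Phi>"
    using lin[OF that, of 1 "-1"] by simp
  show "F (\<lambda>x. a *\<^sub>R u x) = a * F u"
    using lin[OF u, of a 0] by simp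
qed

lemma zero_in_orlicz_space: "(\<lambda>x. 0) \<in> orlicz_space \<Omega> \<Phi>"
  using primal.orlicz_ball_subset[OF primal.zero_in_orlicz_ball] .

lemma norm_dual_zero: "F \<in> norm_dual \<Omega> \<Phi> \<Longrightarrow> F (\<lambda>x. 0) = 0"
  using norm_dual_scaleR[OF _ zero_in_orlicz_space, of F 0] by simp

text \<open>The definition of \<open>norm_dual\<close> leaves the sign of the constant open; a
  nonnegative one is needed to multiply norm estimates.\<close>

lemma norm_dual_bound:
  assumes "F \<in> norm_dual \<Omega> \<Phi>"
  obtains K where "0 \<le> K" "\<And>v. v \<in> orlicz_space \<Omega> \<Phi> \<Longrightarrow> \<bar>F v\<bar> \<le> K * lux_norm \<Omega> \<Phi> v"
proof -
  obtain K where K: "\<And>v. v \<in> orlicz_space \<Omega> \<Phi> \<Longrightarrow> \<bar>F v\<bar> \<le> K * lux_norm \<Omega> \<Phi> v"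
    using assms unfolding norm_dual_def by blast
  show ?thesis
  proof (rule that[of "\<bar>K\<bar>"])
    fix v assume v: "v \<in> orlicz_space \<Omega> \<Phi>"
    show "\<bar>F v\<bar> \<le> \<bar>K\<bar> * lux_norm \<Omega> \<Phi> v"
      using K[OF v] mult_right_mono[OF abs_ge_self primal.lux_norm_nonneg[OF v], of K]
      by (rule order_trans)
  qed simp
qed

lemma orlicz_space_diff:
  assumes u: "u \<in> orlicz_space \<Omega> \<Phi>" and v: "v \<in> orlicz_space \<Omega> \<Phi>"
  shows "(\<lambda>x. u x - v x) \<in> orlicz_space \<Omega> \<Phi>"
  using primal.orlicz_space_add[OF u primal.orlicz_space_scaleR[OF v, of "-1"]] by simp

lemma norm_dual_sum:
  assumes F: "F \<in> norm_dual \<Omega> \<Phi>" and "finite I" "\<And>i. i \<in> I \<Longrightarrow> v i \<in> orlicz_space \<Omega> \<Phi>"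
  shows "(\<lambda>x. \<Sum>i\<in>I. v i x) \<in> orlicz_space \<Omega> \<Phi> \<and> F (\<lambda>x. \<Sum>i\<in>I. v i x) = (\<Sum>i\<in>I. F (v i))"
  using assms(2,3)
proof (induction I rule: finite_induct)
  case empty
  show ?case using zero_in_orlicz_space norm_dual_zero[OF F] by simp
next
  case (insert i I)
  then show ?case
    using primal.orlicz_space_add[of "v i" "\<lambda>x. \<Sum>i\<in>I. v i x"]
      norm_dual_add[OF F, of "v i" "\<lambda>x. \<Sum>i\<in>I. v i x"] by simp
qed

text \<open>Dominated convergence for F, from order continuity of the norm. Domination of the
  difference by the limit u fits its three uses: indicators of growing unions, increasing
  nonnegative functions, and truncations.\<close>

lemma norm_dual_tendsto:
  assumes F: "F \<in> norm_dual \<Omega> \<Phi>"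
    and u: "u \<in> orlicz_space \<Omega> \<Phi>" and w: "\<And>k::nat. w k \<in> orlicz_space \<Omega> \<Phi>"
    and le: "\<And>k. AE x in lebesgue_on \<Omega>. norm (w k x - u x) \<le> norm (u x)"
    and lim: "AE x in lebesgue_on \<Omega>. (\<lambda>k. w k x) \<longlonglongrightarrow> u x"
  shows "(\<lambda>k. F (w k)) \<longlonglongrightarrow> F u"
proof -
  obtain K where K: "0 \<le> K" "\<And>v. v \<in> orlicz_space \<Omega> \<Phi> \<Longrightarrow> \<bar>F v\<bar> \<le> K * lux_norm \<Omega> \<Phi> v"
    using norm_dual_bound[OF F] by blast
  have diff: "(\<lambda>x. w k x - u x) \<in> orlicz_space \<Omega> \<Phi>" for k
    by (rule orlicz_space_diff[OF w u])
  have "(\<lambda>k. lux_norm \<Omega> \<Phi> (\<lambda>x. w k x - u x)) \<longlonglongrightarrow> 0"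
    using lim by (intro lux_norm_tendsto_zero[OF u primal.orlicz_space_L0[OF diff] le])
      (auto elim!: eventually_mono simp: LIM_zero)
  then have "(\<lambda>k. K * lux_norm \<Omega> \<Phi> (\<lambda>x. w k x - u x)) \<longlonglongrightarrow> 0"
    using tendsto_mult_left[of _ 0 sequentially K] by simp
  moreover have "\<forall>\<^sub>F k in sequentially. norm (F (w k) - F u) \<le> K * lux_norm \<Omega> \<Phi> (\<lambda>x. w k x - u x)"
    using K(2)[OF diff] norm_dual_diff[OF F w u] by simp
  ultimately have "(\<lambda>k. F (w k) - F u) \<longlonglongrightarrow> 0"
    by (rule Lim_null_comparison[rotated])
  then show ?thesis by (rule LIM_zero_cancel)
qed

section \<open>Set functions of a functional and their densities\<close>

lemma component_in_orlicz_space: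
  fixes e :: "real ^ 'n"
  assumes u: "u \<in> borel_measurable (lebesgue_on \<Omega>)" "\<And>x. x \<in> \<Omega> \<Longrightarrow> \<bar>u x\<bar> \<le> B"
  shows "(\<lambda>x. u x *\<^sub>R e) \<in> orlicz_space \<Omega> \<Phi>"
proof (rule bounded_in_orlicz_space)
  show "(\<lambda>x. u x *\<^sub>R e) \<in> L0 \<Omega>"
    using u(1) by (simp add: L0_def)
  show "norm (u x *\<^sub>R e) \<le> B * norm e" if "x \<in> \<Omega>" for x
    using u(2)[OF that] by (simp add: mult_right_mono)
qed

lemma indicator_in_orlicz_space:
  fixes e :: "real ^ 'n"
  shows "A \<in> sets (lebesgue_on \<Omega>) \<Longrightarrow> (\<lambda>x. indicator A x *\<^sub>R e) \<in> orlicz_space \<Omega> \<Phi>"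
  by (rule component_in_orlicz_space[where B=1]) (auto simp: indicator_def)

lemma signed_measure_norm_dual:
  fixes e :: "real ^ 'n"
  assumes F: "F \<in> norm_dual \<Omega> \<Phi>"
  shows "signed_measure (lebesgue_on \<Omega>) (\<lambda>A. F (\<lambda>x. indicator A x *\<^sub>R e))"
  unfolding signed_measure_def
proof safe
  fix A :: "nat \<Rightarrow> (real ^ 'n) set"
  assume A: "range A \<subseteq> sets (lebesgue_on \<Omega>)" and disj: "disjoint_family A"
  let ?U = "\<lambda>N. \<Union>n<N. A n"
  have U: "?U N \<in> sets (lebesgue_on \<Omega>)" "(\<Union>n. A n) \<in> sets (lebesgue_on \<Omega>)" for N
    using A by auto
  have sum: "(\<Sum>n<N. F (\<lambda>x. indicator (A n) x *\<^sub>R e)) = F (\<lambda>x. indicator (?U N) x *\<^sub>R e)" for N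
  proof -
    have "indicator (?U N) x = (\<Sum>n<N. indicator (A n) x :: real)" for x
      using disj by (intro indicator_UN_disjoint) (auto simp: disjoint_family_on_def)
    then have "(\<lambda>x. indicator (?U N) x *\<^sub>R e) = (\<lambda>x. \<Sum>n<N. indicator (A n) x *\<^sub>R e)"
      by (simp add: scaleR_left.sum)
    then show ?thesis
      using norm_dual_sum[OF F, of "{..<N}" "\<lambda>n x. indicator (A n) x *\<^sub>R e"]
        indicator_in_orlicz_space A by auto
  qed
  have "(\<lambda>N. F (\<lambda>x. indicator (?U N) x *\<^sub>R e)) \<longlonglongrightarrow> F (\<lambda>x. indicator (\<Union>n. A n) x *\<^sub>R e)"
  proof (rule norm_dual_tendsto[OF F])
    show "AE x in lebesgue_on \<Omega>. (\<lambda>N. indicator (?U N) x *\<^sub>R e) \<longlonglongrightarrow> indicator (\<Union>n. A n) x *\<^sub>R e"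
      by (intro AE_I2 tendsto_scaleR tendsto_const LIMSEQ_indicator_UN)
    \<comment> \<open>Up to sign the difference is e times the indicator of the tail of the
      union.\<close>
    show "AE x in lebesgue_on \<Omega>. norm (indicator (?U N) x *\<^sub>R e - indicator (\<Union>n. A n) x *\<^sub>R e)
        \<le> norm (indicator (\<Union>n. A n) x *\<^sub>R e)" for N
      by (auto simp: indicator_def)
  qed (use U indicator_in_orlicz_space in auto)
  then show "(\<lambda>n. F (\<lambda>x. indicator (A n) x *\<^sub>R e)) sums F (\<lambda>x. indicator (\<Union>n. A n) x *\<^sub>R e)"
    by (simp add: sums_def sum)
qed

lemma norm_dual_indicator_density:
  fixes e :: "real ^ 'n"
  assumes F: "F \<in> norm_dual \<Omega> \<Phi>"
  obtains f :: "real ^ 'n \<Rightarrow> real" where "integrable (lebesgue_on \<Omega>) f"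
    "\<And>A. A \<in> sets (lebesgue_on \<Omega>) \<Longrightarrow>
      F (\<lambda>x. indicator A x *\<^sub>R e) = (\<integral>x. indicator A x * f x \<partial>lebesgue_on \<Omega>)"
proof -
  interpret finite_measure "lebesgue_on \<Omega>"
    by (rule finite_measure_lebesgue_on[OF lmeasurable])
  obtain K where K: "0 \<le> K" "\<And>v. v \<in> orlicz_space \<Omega> \<Phi> \<Longrightarrow> \<bar>F v\<bar> \<le> K * lux_norm \<Omega> \<Phi> v"
    using norm_dual_bound[OF F] by blast
  have "(\<lambda>x. e) \<in> orlicz_space \<Omega> \<Phi>"
    using component_in_orlicz_space[of "\<lambda>_. 1" 1 e] by simp
  \<comment> \<open>One scale c for the constant field e serves all A at once, because restricting e
    to A only lowers the modular; it bounds the set function by \<open>K * c\<close>.\<close>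
  from primal.lux_set_nonempty[OF this] obtain c
    where c: "0 < c" "modular \<Omega> \<Phi> (\<lambda>x. e /\<^sub>R c) \<le> 1" by blast
  have bdd: "\<bar>F (\<lambda>x. indicator A x *\<^sub>R e)\<bar> \<le> K * c" if A: "A \<in> sets (lebesgue_on \<Omega>)" for A
  proof -
    have "modular \<Omega> \<Phi> (\<lambda>x. (indicator A x *\<^sub>R e) /\<^sub>R c) \<le> modular \<Omega> \<Phi> (\<lambda>x. e /\<^sub>R c)"
      by (intro primal.modular_mono AE_I2) (simp add: indicator_def)
    then have "modular \<Omega> \<Phi> (\<lambda>x. (indicator A x *\<^sub>R e) /\<^sub>R c) \<le> 1"
      using c(2) by (rule order_trans)
    from primal.lux_norm_le[OF c(1) this]
    have "K * lux_norm \<Omega> \<Phi> (\<lambda>x. indicator A x *\<^sub>R e) \<le> K * c"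
      using K(1) by (rule mult_left_mono)
    with K(2)[OF indicator_in_orlicz_space[OF A]] show ?thesis
      by (rule order_trans)
  qed
  have null: "F (\<lambda>x. indicator A x *\<^sub>R e) = 0" if A: "A \<in> null_sets (lebesgue_on \<Omega>)" for A
  proof -
    have "AE x in lebesgue_on \<Omega>. indicator A x *\<^sub>R e = 0"
      using AE_not_in[OF A] by (auto elim!: eventually_mono)
    moreover have "(\<lambda>x. indicator A x *\<^sub>R e) \<in> L0 \<Omega>"
      using A by (auto simp: L0_def)
    ultimately show ?thesis
      using primal.lux_norm_AE_zero[of "\<lambda>x. indicator A x *\<^sub>R e"] K(2)[of "\<lambda>x. indicator A x *\<^sub>R e"] by simp
  qed
  show ?thesis
    using signed_Radon_Nikodym[OF signed_measure_norm_dual[OF F, of e] bdd null] that by blast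
qed

text \<open>Extends the identity from indicators to bounded functions by measurable induction on
  nonnegative functions, then by positive and negative parts. In the limit step F follows by
  \<open>norm_dual_tendsto\<close>, the integral by the majorant
  \<open>\<bar>B\<bar> * \<bar>f x\<bar>\<close>.\<close>

lemma norm_dual_component:
  fixes e :: "real ^ 'n"
  assumes F: "F \<in> norm_dual \<Omega> \<Phi>" and f: "integrable (lebesgue_on \<Omega>) f"
    and set: "\<And>A. A \<in> sets (lebesgue_on \<Omega>) \<Longrightarrow>
      F (\<lambda>x. indicator A x *\<^sub>R e) = (\<integral>x. indicator A x * f x \<partial>lebesgue_on \<Omega>)"
    and u: "u \<in> borel_measurable (lebesgue_on \<Omega>)" "\<And>x. x \<in> \<Omega> \<Longrightarrow> \<bar>u x\<bar> \<le> B"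
  shows "integrable (lebesgue_on \<Omega>) (\<lambda>x. u x * f x)"
    and "F (\<lambda>x. u x *\<^sub>R e) = (\<integral>x. u x * f x \<partial>lebesgue_on \<Omega>)"
proof -
  have [measurable]: "f \<in> borel_measurable (lebesgue_on \<Omega>)"
    using f by auto
  have int: "integrable (lebesgue_on \<Omega>) (\<lambda>x. u x * f x)"
    if [measurable]: "u \<in> borel_measurable (lebesgue_on \<Omega>)" and B: "\<And>x. x \<in> \<Omega> \<Longrightarrow> \<bar>u x\<bar> \<le> B" for u B
  proof (rule Bochner_Integration.integrable_bound[where f="\<lambda>x. B * f x"])
    show "AE x in lebesgue_on \<Omega>. norm (u x * f x) \<le> norm (B * f x)"
    proof (rule AE_I2)
      fix x assume "x \<in> space (lebesgue_on \<Omega>)"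
      then have "\<bar>u x\<bar> \<le> \<bar>B\<bar>"
        using order_trans[OF B abs_ge_self, of x] by simp
      then show "norm (u x * f x) \<le> norm (B * f x)"
        by (simp add: abs_mult mult_right_mono)
    qed
  qed (use f in auto)
  \<comment> \<open>The bound is a premise inside the induction statement, with B arbitrary:
    summands and approximants inherit it, whereas removing a factor c changes it to
    \<open>B / c\<close>.\<close>
  have pos: "(\<forall>x\<in>\<Omega>. u x \<le> B) \<Longrightarrow> F (\<lambda>x. u x *\<^sub>R e) = (\<integral>x. u x * f x \<partial>lebesgue_on \<Omega>)"
    if "u \<in> borel_measurable (lebesgue_on \<Omega>)" "\<And>x. 0 \<le> u x" for u and B :: real
    using that
  proof (induction arbitrary: B rule: borel_measurable_induct_real)
    case (set A)
    then show ?case using assms(3) by simp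
  next
    case (mult u c)
    show ?case
    proof (cases "c = 0")
      case True
      then show ?thesis using norm_dual_zero[OF F] by simp
    next
      case False
      then have le: "\<forall>x\<in>\<Omega>. u x \<le> B / c"
        using mult by (auto simp: field_simps)
      have "(\<lambda>x. u x *\<^sub>R e) \<in> orlicz_space \<Omega> \<Phi>"
        using mult le by (intro component_in_orlicz_space[where B="B / c"]) auto
      from norm_dual_scaleR[OF F this, of c] show ?thesis
        using mult.IH[OF le] by (simp add: mult.assoc)
    qed
  next
    case (add u v)
    have le: "\<forall>x\<in>\<Omega>. u x \<le> B" "\<forall>x\<in>\<Omega>. v x \<le> B"
      using add by (auto intro: order_trans[rotated] simp: add_increasing)
    have "(\<lambda>x. u x *\<^sub>R e) \<in> orlicz_space \<Omega> \<Phi>" "(\<lambda>x. v x *\<^sub>R e) \<in> orlicz_space \<Omega> \<Phi>"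
      using add le by (auto intro!: component_in_orlicz_space[where B=B])
    then have "F (\<lambda>x. v x *\<^sub>R e + u x *\<^sub>R e) = F (\<lambda>x. v x *\<^sub>R e) + F (\<lambda>x. u x *\<^sub>R e)"
      by (intro norm_dual_add[OF F])
    moreover have "integrable (lebesgue_on \<Omega>) (\<lambda>x. u x * f x)" "integrable (lebesgue_on \<Omega>) (\<lambda>x. v x * f x)"
      using add le by (auto intro!: int[where B=B])
    ultimately show ?case
      using add.IH le by (simp add: scaleR_add_left distrib_right)
  next
    case (seq U)
    have le_u: "U k x \<le> u x" if "x \<in> \<Omega>" for k x
      using seq.hyps that by (intro incseq_le) (auto simp: incseq_def le_fun_def)
    then have le: "\<forall>x\<in>\<Omega>. U k x \<le> B" for k
      using seq.prems by (meson order_trans)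
    have space: "(\<lambda>x. U k x *\<^sub>R e) \<in> orlicz_space \<Omega> \<Phi>" for k
      using seq.hyps(1,2) le[of k] by (auto intro!: component_in_orlicz_space[where B=B])
    have u_nonneg: "0 \<le> u x" if "x \<in> \<Omega>" for x
      using le_u[OF that] seq.hyps order_trans by blast
    have u_meas: "u \<in> borel_measurable (lebesgue_on \<Omega>)"
      using seq.hyps(4,1) by (rule borel_measurable_LIMSEQ_real)
    have "(\<lambda>k. F (\<lambda>x. U k x *\<^sub>R e)) \<longlonglongrightarrow> F (\<lambda>x. u x *\<^sub>R e)"
    proof (rule norm_dual_tendsto[OF F _ space])
      show "(\<lambda>x. u x *\<^sub>R e) \<in> orlicz_space \<Omega> \<Phi>"
        using u_meas u_nonneg seq.prems by (auto intro!: component_in_orlicz_space[where B=B])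
      show "AE x in lebesgue_on \<Omega>. (\<lambda>k. U k x *\<^sub>R e) \<longlonglongrightarrow> u x *\<^sub>R e"
        using seq.hyps(4) by (intro AE_I2 tendsto_intros)
      show "AE x in lebesgue_on \<Omega>. norm (U k x *\<^sub>R e - u x *\<^sub>R e) \<le> norm (u x *\<^sub>R e)" for k
      proof (rule AE_I2)
        fix x assume x: "x \<in> space (lebesgue_on \<Omega>)"
        then have "\<bar>U k x - u x\<bar> \<le> \<bar>u x\<bar>"
          using le_u[of x k] seq.hyps(2)[of k x] by auto
        then show "norm (U k x *\<^sub>R e - u x *\<^sub>R e) \<le> norm (u x *\<^sub>R e)"
          by (simp flip: scaleR_left_diff_distrib add: mult_right_mono)
      qed
    qed
    moreover have "(\<lambda>k. \<integral>x. U k x * f x \<partial>lebesgue_on \<Omega>) \<longlonglongrightarrow> (\<integral>x. u x * f x \<partial>lebesgue_on \<Omega>)"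
    proof (rule integral_dominated_convergence[where w="\<lambda>x. \<bar>B\<bar> * \<bar>f x\<bar>"])
      show "(\<lambda>x. u x * f x) \<in> borel_measurable (lebesgue_on \<Omega>)"
        "(\<lambda>x. U k x * f x) \<in> borel_measurable (lebesgue_on \<Omega>)" for k
        using u_meas seq.hyps(1) by measurable
      show "AE x in lebesgue_on \<Omega>. (\<lambda>k. U k x * f x) \<longlonglongrightarrow> u x * f x"
        using seq.hyps(4) by (intro AE_I2 tendsto_intros)
      show "AE x in lebesgue_on \<Omega>. norm (U k x * f x) \<le> \<bar>B\<bar> * \<bar>f x\<bar>" for k
      proof (rule AE_I2)
        fix x assume "x \<in> space (lebesgue_on \<Omega>)"
        then have "\<bar>U k x\<bar> \<le> \<bar>B\<bar>"
          using le[of k] seq.hyps(2)[of k x] by (auto intro: order_trans[OF _ abs_ge_self])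
        then show "norm (U k x * f x) \<le> \<bar>B\<bar> * \<bar>f x\<bar>"
          by (simp add: abs_mult mult_right_mono)
      qed
    qed (use f in auto)
    ultimately show ?case
      using seq.IH[OF le] LIMSEQ_unique by simp
  qed
  show "integrable (lebesgue_on \<Omega>) (\<lambda>x. u x * f x)"
    using u by (rule int)
  let ?u1 = "\<lambda>x. max (u x) 0" and ?u2 = "\<lambda>x. max (- u x) 0"
  note [measurable] = u(1)
  have B: "\<bar>?u1 x\<bar> \<le> \<bar>B\<bar>" "\<bar>?u2 x\<bar> \<le> \<bar>B\<bar>" if "x \<in> \<Omega>" for x
    using u(2)[OF that] by auto
  then have B': "\<forall>x\<in>\<Omega>. ?u1 x \<le> \<bar>B\<bar>" "\<forall>x\<in>\<Omega>. ?u2 x \<le> \<bar>B\<bar>"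
    by auto
  have eq: "u x = ?u1 x - ?u2 x" for x by auto
  have "F (\<lambda>x. u x *\<^sub>R e) = F (\<lambda>x. ?u1 x *\<^sub>R e - ?u2 x *\<^sub>R e)"
    by (subst eq) (simp only: scaleR_left_diff_distrib)
  also have "\<dots> = F (\<lambda>x. ?u1 x *\<^sub>R e) - F (\<lambda>x. ?u2 x *\<^sub>R e)"
    using B by (intro norm_dual_diff[OF F] component_in_orlicz_space[where B="\<bar>B\<bar>"]) auto
  also have "\<dots> = (\<integral>x. ?u1 x * f x \<partial>lebesgue_on \<Omega>) - (\<integral>x. ?u2 x * f x \<partial>lebesgue_on \<Omega>)"
    using pos[of ?u1 "\<bar>B\<bar>"] pos[of ?u2 "\<bar>B\<bar>"] B' by simp
  also have "\<dots> = (\<integral>x. ?u1 x * f x - ?u2 x * f x \<partial>lebesgue_on \<Omega>)"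
    using B by (intro Bochner_Integration.integral_diff[symmetric] int[where B="\<bar>B\<bar>"]) auto
  also have "\<dots> = (\<integral>x. u x * f x \<partial>lebesgue_on \<Omega>)"
    by (subst (3) eq) (simp only: left_diff_distrib)
  finally show "F (\<lambda>x. u x *\<^sub>R e) = (\<integral>x. u x * f x \<partial>lebesgue_on \<Omega>)" .
qed

lemma norm_dual_bounded_representation:
  assumes F: "F \<in> norm_dual \<Omega> \<Phi>"
  obtains p where "integrable (lebesgue_on \<Omega>) p"
    "\<And>v B. v \<in> L0 \<Omega> \<Longrightarrow> (\<And>x. norm (v x) \<le> B) \<Longrightarrow> F v = pairing \<Omega> p v"
proof -
  have "\<forall>i. \<exists>f. integrable (lebesgue_on \<Omega>) f \<and> (\<forall>A\<in>sets (lebesgue_on \<Omega>).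
      F (\<lambda>x. indicator A x *\<^sub>R axis i 1) = (\<integral>x. indicator A x * f x \<partial>lebesgue_on \<Omega>))"
    using norm_dual_indicator_density[OF F] by metis
  from choice[OF this] obtain f where *: "\<forall>i. integrable (lebesgue_on \<Omega>) (f i) \<and> (\<forall>A\<in>sets (lebesgue_on \<Omega>).
      F (\<lambda>x. indicator A x *\<^sub>R axis i 1) = (\<integral>x. indicator A x * f i x \<partial>lebesgue_on \<Omega>))" ..
  then have f: "\<And>i. integrable (lebesgue_on \<Omega>) (f i)"
    and F_ind: "\<And>i A. A \<in> sets (lebesgue_on \<Omega>) \<Longrightarrow>
      F (\<lambda>x. indicator A x *\<^sub>R axis i 1) = (\<integral>x. indicator A x * f i x \<partial>lebesgue_on \<Omega>)"
    by blast+
  have expand: "(\<Sum>i\<in>UNIV. (y $ i) *\<^sub>R axis i 1) = y" for y :: "real ^ 'n"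
    using basis_expansion[of y] by (simp add: scalar_mult_eq_scaleR)
  define p where "p x = (\<Sum>i\<in>UNIV. f i x *\<^sub>R axis i (1::real))" for x
  have p_nth: "p x $ i = f i x" for x i
    by (simp add: p_def axis_def if_distrib[of "\<lambda>y. _ * y"] cong: if_cong)
  show ?thesis
  proof (rule that)
    show "integrable (lebesgue_on \<Omega>) p"
      unfolding p_def using f by (intro Bochner_Integration.integrable_sum integrable_scaleR_left)
    fix v :: "real ^ 'n \<Rightarrow> real ^ 'n" and B
    assume v: "v \<in> L0 \<Omega>" and B: "\<And>x. norm (v x) \<le> B"
    have meas: "(\<lambda>x. v x $ i) \<in> borel_measurable (lebesgue_on \<Omega>)" for i
      using v by (simp add: L0_def cart_eq_inner_axis borel_measurable_inner)
    have le: "\<bar>v x $ i\<bar> \<le> B" for x i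
      using component_le_norm_cart[of "v x" i] B[of x] by simp
    have "F v = F (\<lambda>x. \<Sum>i\<in>UNIV. (v x $ i) *\<^sub>R axis i 1)"
      by (simp add: expand)
    also have "\<dots> = (\<Sum>i\<in>UNIV. F (\<lambda>x. (v x $ i) *\<^sub>R axis i 1))"
      using norm_dual_sum[OF F, of UNIV "\<lambda>i x. (v x $ i) *\<^sub>R axis i 1"]
        component_in_orlicz_space[OF meas le] by simp
    also have "\<dots> = (\<Sum>i\<in>UNIV. \<integral>x. v x $ i * f i x \<partial>lebesgue_on \<Omega>)"
      by (intro sum.cong refl norm_dual_component(2)[OF F f F_ind meas le])
    also have "\<dots> = (\<integral>x. (\<Sum>i\<in>UNIV. v x $ i * f i x) \<partial>lebesgue_on \<Omega>)"
      using norm_dual_component(1)[OF F f F_ind meas le]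
      by (intro Bochner_Integration.integral_sum[symmetric])
    also have "\<dots> = pairing \<Omega> p v"
      by (simp add: pairing_def inner_vec_def p_nth mult.commute)
    finally show "F v = pairing \<Omega> p v" .
  qed
qed

lemma norm_dual_representation:
  assumes F: "F \<in> norm_dual \<Omega> \<Phi>"
  obtains p where "p \<in> orlicz_space \<Omega> (conjugate \<phi>)" "F = pairing_functional \<Omega> \<Phi> p"
proof -
  obtain p where p: "integrable (lebesgue_on \<Omega>) p"
    and Fp: "\<And>v B. v \<in> L0 \<Omega> \<Longrightarrow> (\<And>x. norm (v x) \<le> B) \<Longrightarrow> F v = pairing \<Omega> p v"
    using norm_dual_bounded_representation[OF F] by blast
  obtain K where K: "0 \<le> K" "\<And>v. v \<in> orlicz_space \<Omega> \<Phi> \<Longrightarrow> \<bar>F v\<bar> \<le> K * lux_norm \<Omega> \<Phi> v"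
    using norm_dual_bound[OF F] by blast
  have p_space: "p \<in> orlicz_space \<Omega> (conjugate \<phi>)"
  proof (rule lux_norm_conjugate_le(1)[OF p K(1)])
    fix v B assume v: "v \<in> L0 \<Omega>" and B: "\<And>x. norm (v x) \<le> B" and le: "modular \<Omega> \<Phi> v \<le> 1"
    from v le have "v \<in> orlicz_ball \<Omega> \<Phi>"
      by (rule primal.orlicz_ballI)
    then have "\<bar>F v\<bar> \<le> K * lux_norm \<Omega> \<Phi> v" "K * lux_norm \<Omega> \<Phi> v \<le> K * 1"
      using K mult_left_mono[of "lux_norm \<Omega> \<Phi> v" 1 K] by (auto simp: orlicz_ball_def)
    then show "pairing \<Omega> p v \<le> K"
      using Fp[OF v B] by simp
  qed
  have "F v = pairing \<Omega> p v" if v: "v \<in> orlicz_space \<Omega> \<Phi>" for v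
  proof -
    \<comment> \<open>Cutting off to 0, instead of rescaling to length k, makes
      \<open>w k x - v x\<close> either 0 or \<open>- v x\<close>, so it is dominated by v; likewise
      \<open>p x \<bullet> w k x\<close> is either 0 or \<open>p x \<bullet> v x\<close>.\<close>
    define w where "w k x = (if norm (v x) \<le> real k then v x else 0)" for k x
    have [measurable]: "v \<in> borel_measurable (lebesgue_on \<Omega>)" "p \<in> borel_measurable (lebesgue_on \<Omega>)"
      using primal.orlicz_space_L0[OF v] p by (auto simp: L0_def)
    have w_L0: "w k \<in> L0 \<Omega>" for k
      unfolding L0_def w_def by measurable
    then have [measurable]: "w k \<in> borel_measurable (lebesgue_on \<Omega>)" for k
      by (simp add: L0_def)
    have w_le: "norm (w k x) \<le> norm (v x)" "norm (w k x) \<le> real k" for k x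
      by (auto simp: w_def)
    have lim: "(\<lambda>k. w k x) \<longlonglongrightarrow> v x" for x
    proof (rule tendsto_eventually)
      obtain N where N: "norm (v x) \<le> real N"
        using real_arch_simple by blast
      show "\<forall>\<^sub>F k in sequentially. w k x = v x"
        using N by (intro eventually_mono[OF eventually_ge_at_top[of N]])
          (auto simp: w_def intro: order_trans)
    qed
    have "(\<lambda>k. F (w k)) \<longlonglongrightarrow> F v"
    proof (rule norm_dual_tendsto[OF F v])
      show "w k \<in> orlicz_space \<Omega> \<Phi>" for k
        using w_le by (intro primal.orlicz_space_mono[OF v w_L0]) auto
      show "AE x in lebesgue_on \<Omega>. norm (w k x - v x) \<le> norm (v x)" for k
        by (auto simp: w_def)
    qed (use lim in auto)
    moreover have "(\<lambda>k. pairing \<Omega> p (w k)) \<longlonglongrightarrow> pairing \<Omega> p v"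
      unfolding pairing_def
    proof (rule integral_dominated_convergence[where w="\<lambda>x. \<bar>p x \<bullet> v x\<bar>"])
      show "integrable (lebesgue_on \<Omega>) (\<lambda>x. \<bar>p x \<bullet> v x\<bar>)"
        using pairing_integrable[OF p_space v] by simp
      show "AE x in lebesgue_on \<Omega>. (\<lambda>k. p x \<bullet> w k x) \<longlonglongrightarrow> p x \<bullet> v x"
        using lim by (intro AE_I2 tendsto_intros) auto
      show "AE x in lebesgue_on \<Omega>. norm (p x \<bullet> w k x) \<le> \<bar>p x \<bullet> v x\<bar>" for k
        by (auto simp: w_def)
    qed measurable
    moreover have "F (w k) = pairing \<Omega> p (w k)" for k
      using w_L0 w_le(2) by (rule Fp)
    ultimately show ?thesis
      using LIMSEQ_unique by simp
  qed
  moreover have "F \<in> extensional (orlicz_space \<Omega> \<Phi>)"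
    using F by (simp add: norm_dual_def)
  ultimately have "F = pairing_functional \<Omega> \<Phi> p"
    unfolding pairing_functional_def by (auto intro!: extensionalityI)
  with p_space show ?thesis by (rule that)
qed

end

section \<open>The duality\<close>

context musielak_orlicz
begin

lemma associate_sup_le:
  assumes p: "p \<in> orlicz_space \<Omega> (conjugate \<phi>)"
  shows "associate_sup \<Omega> \<Phi> p \<le> ennreal (2 * lux_norm \<Omega> (conjugate \<phi>) p)"
  unfolding associate_sup_def
proof (rule SUP_least)
  fix v assume v: "v \<in> orlicz_ball \<Omega> \<Phi>"
  have "2 * lux_norm \<Omega> (conjugate \<phi>) p * lux_norm \<Omega> \<Phi> v \<le> 2 * lux_norm \<Omega> (conjugate \<phi>) p"
    using dual.lux_norm_nonneg[OF p] primal.orlicz_ball_lux_norm[OF v]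
    by (simp add: mult_left_le)
  with Hoelder[OF p primal.orlicz_ball_subset[OF v]]
  show "(\<integral>\<^sup>+x. ennreal \<bar>p x \<bullet> v x\<bar> \<partial>lebesgue_on \<Omega>) \<le> ennreal (2 * lux_norm \<Omega> (conjugate \<phi>) p)"
    using ennreal_leI order_trans by blast
qed

text \<open>A multiple of \<open>sgn (p x)\<close> lies in the unit ball, so the associate norm
  controls the integral of \<open>norm (p x)\<close>. Integrability is the entry condition of the
  test argument.\<close>

lemma associate_space_integrable:
  assumes p: "p \<in> associate_space \<Omega> \<Phi>"
  shows "integrable (lebesgue_on \<Omega>) p"
proof -
  have p_L0: "p \<in> L0 \<Omega>" and fin: "associate_sup \<Omega> \<Phi> p < \<infinity>"
    using p by (auto simp: associate_space_def)
  have [measurable]: "p \<in> borel_measurable (lebesgue_on \<Omega>)"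
    using p_L0 by (simp add: L0_def)
  have sgn: "(\<lambda>x. sgn (p x)) \<in> orlicz_space \<Omega> \<Phi>"
    by (rule sgn_in_orlicz_space[OF p_L0])
  obtain c where c: "0 < c" "modular \<Omega> \<Phi> (\<lambda>x. sgn (p x) /\<^sub>R c) \<le> 1"
    using primal.lux_set_nonempty[OF sgn] by blast
  have "(\<lambda>x. sgn (p x) /\<^sub>R c) \<in> orlicz_ball \<Omega> \<Phi>"
    using c(2) by (rule primal.orlicz_ballI[OF primal.L0_scaleR[OF primal.orlicz_space_L0[OF sgn]]])
  then have "(\<integral>\<^sup>+x. ennreal \<bar>p x \<bullet> (sgn (p x) /\<^sub>R c)\<bar> \<partial>lebesgue_on \<Omega>) \<le> associate_sup \<Omega> \<Phi> p"
    unfolding associate_sup_def by (rule SUP_upper)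
  with fin have "(\<integral>\<^sup>+x. ennreal \<bar>p x \<bullet> (sgn (p x) /\<^sub>R c)\<bar> \<partial>lebesgue_on \<Omega>) < \<infinity>"
    by (rule le_less_trans[rotated])
  then have "integrable (lebesgue_on \<Omega>) (\<lambda>x. inverse c * norm (p x))"
    using c(1) by (intro integrableI_bounded) (simp_all add: inner_sgn_self abs_mult)
  then have "integrable (lebesgue_on \<Omega>) (\<lambda>x. norm (p x))"
    using c(1) by simp
  then show ?thesis
    by (simp add: integrable_norm_iff)
qed

lemma lux_norm_le_associate_norm:
  assumes p: "p \<in> associate_space \<Omega> \<Phi>"
  shows "p \<in> orlicz_space \<Omega> (conjugate \<phi>)"
    and "lux_norm \<Omega> (conjugate \<phi>) p \<le> associate_norm \<Omega> \<Phi> p"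
proof -
  have int: "integrable (lebesgue_on \<Omega>) p"
    by (rule associate_space_integrable[OF p])
  have nonneg: "0 \<le> associate_norm \<Omega> \<Phi> p"
    by (simp add: associate_norm_def)
  have test: "pairing \<Omega> p v \<le> associate_norm \<Omega> \<Phi> p"
    if v: "v \<in> L0 \<Omega>" "\<And>x. norm (v x) \<le> B" "modular \<Omega> \<Phi> v \<le> 1" for v B
  proof -
    have "ennreal \<bar>pairing \<Omega> p v\<bar> \<le> (\<integral>\<^sup>+x. ennreal \<bar>p x \<bullet> v x\<bar> \<partial>lebesgue_on \<Omega>)"
      using integral_norm_bound_ennreal[OF bounded_pairing_integrable[OF int v(1,2)]]
      by (simp add: pairing_def)
    also have "\<dots> \<le> associate_sup \<Omega> \<Phi> p"
      unfolding associate_sup_def by (rule SUP_upper[OF primal.orlicz_ballI[OF v(1,3)]])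
    also have "\<dots> = ennreal (associate_norm \<Omega> \<Phi> p)"
      using p by (simp add: associate_norm_def associate_space_def)
    finally show ?thesis
      using nonneg by simp
  qed
  show "p \<in> orlicz_space \<Omega> (conjugate \<phi>)"
    by (rule lux_norm_conjugate_le(1)[OF int nonneg]) (rule test)
  show "lux_norm \<Omega> (conjugate \<phi>) p \<le> associate_norm \<Omega> \<Phi> p"
    by (rule lux_norm_conjugate_le(2)[OF int nonneg]) (rule test)
qed

lemma associate_space_eq: "associate_space \<Omega> \<Phi> = orlicz_space \<Omega> (conjugate \<phi>)"
proof safe
  fix p assume p: "p \<in> orlicz_space \<Omega> (conjugate \<phi>)"
  have "associate_sup \<Omega> \<Phi> p < \<infinity>"
    using associate_sup_le[OF p] by (rule le_less_trans) simp
  then show "p \<in> associate_space \<Omega> \<Phi>"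
    using dual.orlicz_space_L0[OF p] by (simp add: associate_space_def)
qed (rule lux_norm_le_associate_norm)

text \<open>The lower constant 1 comes from the test argument, the upper constant 2 from
  \<open>Hoelder\<close>.\<close>

lemma associate_norm_equivalent:
  "equivalent_norms_on (orlicz_space \<Omega> (conjugate \<phi>))
     (lux_norm \<Omega> (conjugate \<phi>)) (associate_norm \<Omega> \<Phi>)"
  unfolding equivalent_norms_on_def
proof (rule exI[of _ 1], intro conjI exI[of _ 2] ballI)
  fix p assume p: "p \<in> orlicz_space \<Omega> (conjugate \<phi>)"
  show "1 * lux_norm \<Omega> (conjugate \<phi>) p \<le> associate_norm \<Omega> \<Phi> p"
    using lux_norm_le_associate_norm(2) p associate_space_eq by simp
  show "associate_norm \<Omega> \<Phi> p \<le> 2 * lux_norm \<Omega> (conjugate \<phi>) p"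
    unfolding associate_norm_def
    using associate_sup_le[OF p] dual.lux_norm_nonneg[OF p] by (intro enn2real_leI) auto
qed auto

section \<open>The pairing map onto the dual\<close>

lemma pairing_linear_left:
  assumes p: "p \<in> orlicz_space \<Omega> (conjugate \<phi>)" and q: "q \<in> orlicz_space \<Omega> (conjugate \<phi>)"
    and v: "v \<in> orlicz_space \<Omega> \<Phi>"
  shows "pairing \<Omega> (\<lambda>x. a *\<^sub>R p x + b *\<^sub>R q x) v = a * pairing \<Omega> p v + b * pairing \<Omega> q v"
  using pairing_integrable[OF p v] pairing_integrable[OF q v]
  by (simp add: pairing_def inner_add_left)

lemma pairing_linear_right:
  assumes p: "p \<in> orlicz_space \<Omega> (conjugate \<phi>)"
    and u: "u \<in> orlicz_space \<Omega> \<Phi>" and v: "v \<in> orlicz_space \<Omega> \<Phi>"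
  shows "pairing \<Omega> p (\<lambda>x. a *\<^sub>R u x + b *\<^sub>R v x) = a * pairing \<Omega> p u + b * pairing \<Omega> p v"
  using pairing_integrable[OF p u] pairing_integrable[OF p v]
  by (simp add: pairing_def inner_add_right)

lemma pairing_functional_in_norm_dual:
  assumes p: "p \<in> orlicz_space \<Omega> (conjugate \<phi>)"
  shows "pairing_functional \<Omega> \<Phi> p \<in> norm_dual \<Omega> \<Phi>"
  unfolding norm_dual_def pairing_functional_def
  using abs_pairing_le[OF p] pairing_linear_right[OF p]
    primal.orlicz_space_add[OF primal.orlicz_space_scaleR primal.orlicz_space_scaleR]
  by auto

lemma range_pairing_functional:
  "pairing_functional \<Omega> \<Phi> ` orlicz_space \<Omega> (conjugate \<phi>) = norm_dual \<Omega> \<Phi>"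
  using pairing_functional_in_norm_dual norm_dual_representation by blast

text \<open>If the functionals agree, testing them with the bounded field
  \<open>sgn (p x - q x)\<close> makes the integral of \<open>norm (p x - q x)\<close>
  vanish.\<close>

lemma pairing_functional_eq_iff:
  assumes p: "p \<in> orlicz_space \<Omega> (conjugate \<phi>)" and q: "q \<in> orlicz_space \<Omega> (conjugate \<phi>)"
  shows "pairing_functional \<Omega> \<Phi> p = pairing_functional \<Omega> \<Phi> q \<longleftrightarrow> (AE x in lebesgue_on \<Omega>. p x = q x)"
proof
  assume eq: "pairing_functional \<Omega> \<Phi> p = pairing_functional \<Omega> \<Phi> q"
  define r where "r x = p x - q x" for x
  have r: "r \<in> orlicz_space \<Omega> (conjugate \<phi>)"
    unfolding r_def
    using dual.orlicz_space_add[OF p dual.orlicz_space_scaleR[OF q, of "-1"]] by simp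
  have v: "(\<lambda>x. sgn (r x)) \<in> orlicz_space \<Omega> \<Phi>"
    by (rule sgn_in_orlicz_space[OF dual.orlicz_space_L0[OF r]])
  have "pairing \<Omega> p (\<lambda>x. sgn (r x)) = pairing \<Omega> q (\<lambda>x. sgn (r x))"
    using fun_cong[OF eq, of "\<lambda>x. sgn (r x)"] v by (simp add: pairing_functional_def)
  then have "(\<integral>x. norm (r x) \<partial>lebesgue_on \<Omega>) = 0"
    using pairing_linear_left[OF p q v, of 1 "-1"]
    by (simp add: pairing_def inner_sgn_self flip: r_def)
  then have "AE x in lebesgue_on \<Omega>. norm (r x) = 0"
    using conjugate_space_integrable[OF r]
    by (subst (asm) integral_nonneg_eq_0_iff_AE) auto
  then show "AE x in lebesgue_on \<Omega>. p x = q x"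
    by (simp add: r_def)
next
  assume eq: "AE x in lebesgue_on \<Omega>. p x = q x"
  have [measurable]: "p \<in> borel_measurable (lebesgue_on \<Omega>)" "q \<in> borel_measurable (lebesgue_on \<Omega>)"
    using p q dual.orlicz_space_L0 by (auto simp: L0_def)
  have "pairing \<Omega> p v = pairing \<Omega> q v" if "v \<in> orlicz_space \<Omega> \<Phi>" for v
  proof -
    have [measurable]: "v \<in> borel_measurable (lebesgue_on \<Omega>)"
      using that primal.orlicz_space_L0 by (auto simp: L0_def)
    show ?thesis
      unfolding pairing_def using eq by (intro integral_cong_AE) (auto elim!: eventually_mono)
  qed
  then show "pairing_functional \<Omega> \<Phi> p = pairing_functional \<Omega> \<Phi> q"
    unfolding pairing_functional_def by (intro restrict_ext)
qed

text \<open>The constants arise as for the associate norm. The lower bound needs only signed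
  pairings with bounded fields of modular at most 1, which lie in the unit ball.\<close>

lemma dual_norm_equivalent:
  "equivalent_norms_on (orlicz_space \<Omega> (conjugate \<phi>))
     (lux_norm \<Omega> (conjugate \<phi>)) (\<lambda>p. dual_norm \<Omega> \<Phi> (pairing_functional \<Omega> \<Phi> p))"
  unfolding equivalent_norms_on_def
proof (rule exI[of _ 1], intro conjI exI[of _ 2] ballI)
  fix p assume p: "p \<in> orlicz_space \<Omega> (conjugate \<phi>)"
  have eq: "pairing_functional \<Omega> \<Phi> p v = pairing \<Omega> p v" if "v \<in> orlicz_ball \<Omega> \<Phi>" for v
    using primal.orlicz_ball_subset[OF that] by (simp add: pairing_functional_def)
  have le: "\<bar>pairing_functional \<Omega> \<Phi> p v\<bar> \<le> 2 * lux_norm \<Omega> (conjugate \<phi>) p"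
    if v: "v \<in> orlicz_ball \<Omega> \<Phi>" for v
  proof -
    have "2 * lux_norm \<Omega> (conjugate \<phi>) p * lux_norm \<Omega> \<Phi> v \<le> 2 * lux_norm \<Omega> (conjugate \<phi>) p"
      using dual.lux_norm_nonneg[OF p] primal.orlicz_ball_lux_norm[OF v]
      by (simp add: mult_left_le)
    with abs_pairing_le[OF p primal.orlicz_ball_subset[OF v]] show ?thesis
      using eq[OF v] by simp
  qed
  then show "dual_norm \<Omega> \<Phi> (pairing_functional \<Omega> \<Phi> p) \<le> 2 * lux_norm \<Omega> (conjugate \<phi>) p"
    unfolding dual_norm_def using primal.zero_in_orlicz_ball by (intro cSUP_least) auto
  have upper: "\<bar>pairing \<Omega> p v\<bar> \<le> dual_norm \<Omega> \<Phi> (pairing_functional \<Omega> \<Phi> p)"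
    if v: "v \<in> orlicz_ball \<Omega> \<Phi>" for v
    \<comment> \<open>\<open>dual_norm\<close> is a real supremum, so the upper estimate is also
      needed to bound its set from above.\<close>
    unfolding dual_norm_def eq[OF v, symmetric] using le v
    by (intro cSUP_upper bdd_aboveI2[where M="2 * lux_norm \<Omega> (conjugate \<phi>) p"]) auto
  have "0 \<le> dual_norm \<Omega> \<Phi> (pairing_functional \<Omega> \<Phi> p)"
    using order_trans[OF abs_ge_zero upper[OF primal.zero_in_orlicz_ball]] .
  moreover have "pairing \<Omega> p v \<le> dual_norm \<Omega> \<Phi> (pairing_functional \<Omega> \<Phi> p)"
    if "v \<in> L0 \<Omega>" "modular \<Omega> \<Phi> v \<le> 1" for v
    using upper[OF primal.orlicz_ballI[OF that]] by simp
  ultimately show "1 * lux_norm \<Omega> (conjugate \<phi>) p \<le> dual_norm \<Omega> \<Phi> (pairing_functional \<Omega> \<Phi> p)"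
    using lux_norm_conjugate_le(2)[OF conjugate_space_integrable[OF p]] by simp
qed auto

lemma order_continuous: "order_continuous_norm \<Omega> \<Phi>"
  unfolding order_continuous_norm_def
  using lux_norm_tendsto_zero primal.orlicz_space_L0 by blast

end

text \<open>
  All spaces and norms depend on the integrand only through its modular. So \<open>\<phi>\<close> may be replaced by
  \<open>0\<close> on a null set, after which the almost everywhere hypotheses hold everywhere.
\<close>

lemma modular_cong:
  assumes "modular \<Omega> \<psi> = modular \<Omega> \<psi>'"
  shows "orlicz_space \<Omega> \<psi> = orlicz_space \<Omega> \<psi>'"
    and "lux_norm \<Omega> \<psi> = lux_norm \<Omega> \<psi>'"
    and "associate_space \<Omega> \<psi> = associate_space \<Omega> \<psi>'"
    and "associate_norm \<Omega> \<psi> = associate_norm \<Omega> \<psi>'"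
    and "order_continuous_norm \<Omega> \<psi> = order_continuous_norm \<Omega> \<psi>'"
    and "pairing_functional \<Omega> \<psi> = pairing_functional \<Omega> \<psi>'"
    and "norm_dual \<Omega> \<psi> = norm_dual \<Omega> \<psi>'"
    and "dual_norm \<Omega> \<psi> = dual_norm \<Omega> \<psi>'"
proof -
  show space: "orlicz_space \<Omega> \<psi> = orlicz_space \<Omega> \<psi>'"
    by (simp add: orlicz_space_def assms)
  show norm: "lux_norm \<Omega> \<psi> = lux_norm \<Omega> \<psi>'"
    by (intro ext) (simp add: lux_norm_def assms)
  have ball: "orlicz_ball \<Omega> \<psi> = orlicz_ball \<Omega> \<psi>'"
    by (simp add: orlicz_ball_def space norm)
  have sup: "associate_sup \<Omega> \<psi> = associate_sup \<Omega> \<psi>'"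
    by (intro ext) (simp add: associate_sup_def ball)
  show "associate_space \<Omega> \<psi> = associate_space \<Omega> \<psi>'"
    by (simp add: associate_space_def sup)
  show "associate_norm \<Omega> \<psi> = associate_norm \<Omega> \<psi>'"
    by (intro ext) (simp add: associate_norm_def sup)
  show "order_continuous_norm \<Omega> \<psi> = order_continuous_norm \<Omega> \<psi>'"
    by (simp add: order_continuous_norm_def space norm)
  show "pairing_functional \<Omega> \<psi> = pairing_functional \<Omega> \<psi>'"
    by (intro ext) (simp add: pairing_functional_def space)
  show "norm_dual \<Omega> \<psi> = norm_dual \<Omega> \<psi>'"
    by (simp add: norm_dual_def space norm)
  show "dual_norm \<Omega> \<psi> = dual_norm \<Omega> \<psi>'"
    by (intro ext) (simp add: dual_norm_def ball)
qed

lemma musielak_orlicz_representative: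
  assumes lmeasurable: "\<Omega> \<in> lmeasurable"
    and nonneg: "\<forall>x\<in>\<Omega>. \<forall>t\<ge>0. 0 \<le> \<phi> x t"
    and ae: "AE x in lebesgue_on \<Omega>. convex_on {0..} (\<phi> x) \<and> mono_on {0..} (\<phi> x) \<and>
           continuous_on {0..} (\<phi> x) \<and> \<phi> x 0 = 0"
    and int: "\<forall>t\<ge>0. integrable (lebesgue_on \<Omega>) (\<lambda>x. \<phi> x t)"
    and doubling: "AE x in lebesgue_on \<Omega>. \<forall>t\<ge>0. \<phi> x (2 * t) \<le> C * \<phi> x t"
  obtains \<phi>' where "musielak_orlicz \<Omega> \<phi>' (max C 0)"
    "modular \<Omega> (integrand \<phi>) = modular \<Omega> (integrand \<phi>')"
    "modular \<Omega> (conjugate \<phi>) = modular \<Omega> (conjugate \<phi>')"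
proof -
  have "AE x in lebesgue_on \<Omega>. convex_on {0..} (\<phi> x) \<and> mono_on {0..} (\<phi> x) \<and>
      continuous_on {0..} (\<phi> x) \<and> \<phi> x 0 = 0 \<and> (\<forall>t\<ge>0. \<phi> x (2 * t) \<le> C * \<phi> x t)"
    using ae doubling by eventually_elim auto
  then obtain N where N: "emeasure (lebesgue_on \<Omega>) N = 0" "N \<in> sets (lebesgue_on \<Omega>)"
    and sub: "{x \<in> space (lebesgue_on \<Omega>). \<not> (convex_on {0..} (\<phi> x) \<and> mono_on {0..} (\<phi> x) \<and>
      continuous_on {0..} (\<phi> x) \<and> \<phi> x 0 = 0 \<and> (\<forall>t\<ge>0. \<phi> x (2 * t) \<le> C * \<phi> x t))} \<subseteq> N"
    by (rule AE_E) blast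
  \<comment> \<open>The zero integrand meets all pointwise conditions. It is also used outside
    \<Omega>, where nothing is assumed of \<phi> but the locale quantifies over every x. The
    conjugate changes as well, within \<Omega> only on the null set N.\<close>
  define \<phi>' where "\<phi>' x = (if x \<in> \<Omega> - N then \<phi> x else (\<lambda>t. 0))" for x
  have good: "convex_on {0..} (\<phi> x)" "mono_on {0..} (\<phi> x)" "continuous_on {0..} (\<phi> x)" "\<phi> x 0 = 0"
      "\<And>t. 0 \<le> t \<Longrightarrow> \<phi> x (2 * t) \<le> C * \<phi> x t" if "x \<in> \<Omega> - N" for x
    using sub that by auto
  have eq: "AE x in lebesgue_on \<Omega>. \<phi> x = \<phi>' x"
  proof -
    have "AE x in lebesgue_on \<Omega>. x \<notin> N"
      using N by (intro AE_not_in) auto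
    with AE_space show ?thesis
      by eventually_elim (auto simp: \<phi>'_def)
  qed
  show ?thesis
  proof (rule that)
    show "musielak_orlicz \<Omega> \<phi>' (max C 0)"
    proof
      fix x :: "real ^ 'a" and t :: real
      show "0 \<le> \<phi>' x t" if "0 \<le> t"
        using nonneg that by (simp add: \<phi>'_def)
      \<comment> \<open>Nonnegativity of \<phi> permits enlarging C to \<open>max C 0\<close>, as
        the locale wants a nonnegative constant.\<close>
      show "\<phi>' x (2 * t) \<le> max C 0 * \<phi>' x t" if t: "0 \<le> t"
      proof (cases "x \<in> \<Omega> - N")
        case True
        then have "\<phi> x (2 * t) \<le> C * \<phi> x t"
          using good(5) t by blast
        also have "\<dots> \<le> max C 0 * \<phi> x t"
          using nonneg True t by (intro mult_right_mono) auto
        finally show ?thesis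
          using True by (simp add: \<phi>'_def)
      qed (auto simp: \<phi>'_def)
      show "integrable (lebesgue_on \<Omega>) (\<lambda>x. \<phi>' x t)" if "0 \<le> t"
      proof -
        have t: "integrable (lebesgue_on \<Omega>) (\<lambda>x. \<phi> x t)"
          using int that by blast
        have "(\<lambda>x. if x \<in> N then 0 else \<phi> x t) \<in> borel_measurable (lebesgue_on \<Omega>)"
          using N t by (intro measurable_If_set) auto
        then have "(\<lambda>x. \<phi>' x t) \<in> borel_measurable (lebesgue_on \<Omega>)"
          by (rule measurable_cong[THEN iffD1, rotated]) (auto simp: \<phi>'_def)
        moreover have "AE x in lebesgue_on \<Omega>. \<phi> x t = \<phi>' x t"
          using eq by eventually_elim simp
        ultimately show ?thesis
          using t integrable_cong_AE[of "\<lambda>x. \<phi> x t" "lebesgue_on \<Omega>" "\<lambda>x. \<phi>' x t"] by blast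
      qed
    qed (use lmeasurable good in \<open>auto simp: \<phi>'_def convex_on_def mono_on_def\<close>)
    show "modular \<Omega> (integrand \<phi>) = modular \<Omega> (integrand \<phi>')"
      unfolding modular_def using eq
      by (intro ext nn_integral_cong_AE) (auto elim!: eventually_mono)
    show "modular \<Omega> (conjugate \<phi>) = modular \<Omega> (conjugate \<phi>')"
      unfolding modular_def conjugate_def using eq
      by (intro ext nn_integral_cong_AE) (auto elim!: eventually_mono)
  qed
qed

theorem lemma3p6:
  fixes \<Omega> :: "(real ^ 'n) set"
    and \<phi> :: "real ^ 'n \<Rightarrow> real \<Rightarrow> real"
  assumes "bounded \<Omega>"
    and "lipschitz_domain \<Omega>"
    and "\<forall>x\<in>\<Omega>. \<forall>t\<ge>0. 0 \<le> \<phi> x t"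
    and "\<forall>t\<ge>0. (\<lambda>x. \<phi> x t) \<in> borel_measurable (lebesgue_on \<Omega>)"
    and "AE x in lebesgue_on \<Omega>. convex_on {0..} (\<phi> x) \<and> mono_on {0..} (\<phi> x) \<and>
           continuous_on {0..} (\<phi> x) \<and> \<phi> x 0 = 0"
    and "\<forall>t\<ge>0. integrable (lebesgue_on \<Omega>) (\<lambda>x. \<phi> x t)"
    and "\<exists>C. AE x in lebesgue_on \<Omega>. \<forall>t\<ge>0. \<phi> x (2 * t) \<le> C * \<phi> x t"
    and "((\<lambda>t. ess_inf (lebesgue_on \<Omega>) (\<lambda>x. ereal (\<phi> x t / t))) \<longlongrightarrow> \<infinity>) at_top"
  shows
    "associate_space \<Omega> (integrand \<phi>) = orlicz_space \<Omega> (conjugate \<phi>) \<and>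
     equivalent_norms_on (orlicz_space \<Omega> (conjugate \<phi>))
       (lux_norm \<Omega> (conjugate \<phi>)) (associate_norm \<Omega> (integrand \<phi>)) \<and>
     (\<forall>p\<in>orlicz_space \<Omega> (conjugate \<phi>). \<forall>v\<in>orlicz_space \<Omega> (integrand \<phi>).
       integrable (lebesgue_on \<Omega>) (\<lambda>x. p x \<bullet> v x)) \<and>
     order_continuous_norm \<Omega> (integrand \<phi>) \<and>
     pairing_functional \<Omega> (integrand \<phi>) ` orlicz_space \<Omega> (conjugate \<phi>)
       = norm_dual \<Omega> (integrand \<phi>) \<and>
     (\<forall>p\<in>orlicz_space \<Omega> (conjugate \<phi>). \<forall>q\<in>orlicz_space \<Omega> (conjugate \<phi>).
       pairing_functional \<Omega> (integrand \<phi>) p = pairing_functional \<Omega> (integrand \<phi>) q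
         \<longleftrightarrow> (AE x in lebesgue_on \<Omega>. p x = q x)) \<and>
     (\<forall>p\<in>orlicz_space \<Omega> (conjugate \<phi>). \<forall>q\<in>orlicz_space \<Omega> (conjugate \<phi>). \<forall>a b.
       \<forall>v\<in>orlicz_space \<Omega> (integrand \<phi>).
         pairing_functional \<Omega> (integrand \<phi>) (\<lambda>x. a *\<^sub>R p x + b *\<^sub>R q x) v
           = a * pairing_functional \<Omega> (integrand \<phi>) p v
             + b * pairing_functional \<Omega> (integrand \<phi>) q v) \<and>
     equivalent_norms_on (orlicz_space \<Omega> (conjugate \<phi>))
       (lux_norm \<Omega> (conjugate \<phi>))
       (\<lambda>p. dual_norm \<Omega> (integrand \<phi>) (pairing_functional \<Omega> (integrand \<phi>) p)) \<and>
     (\<forall>v\<in>orlicz_space \<Omega> (integrand \<phi>). \<forall>p\<in>orlicz_space \<Omega> (conjugate \<phi>).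
       (\<integral>\<^sup>+ x. ennreal \<bar>p x \<bullet> v x\<bar> \<partial>lebesgue_on \<Omega>)
         \<le> ennreal (2 * lux_norm \<Omega> (conjugate \<phi>) p * lux_norm \<Omega> (integrand \<phi>) v))"
proof -
  obtain C where C: "AE x in lebesgue_on \<Omega>. \<forall>t\<ge>0. \<phi> x (2 * t) \<le> C * \<phi> x t"
    using assms(7) by blast
  have "\<Omega> \<in> lmeasurable"
    using assms(1,2) by (auto simp: lipschitz_domain_def intro: lmeasurable_open)
  from musielak_orlicz_representative[OF this assms(3,5,6) C] obtain \<phi>'
    where \<phi>': "musielak_orlicz \<Omega> \<phi>' (max C 0)"
      and primal_eq: "modular \<Omega> (integrand \<phi>) = modular \<Omega> (integrand \<phi>')"
      and dual_eq: "modular \<Omega> (conjugate \<phi>) = modular \<Omega> (conjugate \<phi>')" .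
  interpret musielak_orlicz \<Omega> \<phi>' "max C 0"
    by (rule \<phi>')
  have linear: "pairing_functional \<Omega> (integrand \<phi>') (\<lambda>x. a *\<^sub>R p x + b *\<^sub>R q x) v
      = a * pairing_functional \<Omega> (integrand \<phi>') p v + b * pairing_functional \<Omega> (integrand \<phi>') q v"
    if "p \<in> orlicz_space \<Omega> (conjugate \<phi>')" "q \<in> orlicz_space \<Omega> (conjugate \<phi>')"
      "v \<in> orlicz_space \<Omega> (integrand \<phi>')" for p q v a b
    using pairing_linear_left[OF that] that(3) by (simp add: pairing_functional_def)
  \<comment> \<open>All spaces, norms and functionals in the claim see the integrands through their
    modulars only, so rewriting by \<open>primal_eq\<close> and \<open>dual_eq\<close> turns the
    claim into the one for \<phi>'.\<close>
  show ?thesis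
    unfolding modular_cong[OF primal_eq] modular_cong[OF dual_eq]
    by (intro conjI ballI allI associate_space_eq associate_norm_equivalent pairing_integrable
        order_continuous range_pairing_functional pairing_functional_eq_iff linear
        dual_norm_equivalent Hoelder)
qed

end
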